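(* Let $h\in BC(\mathbb{R}^n)$ and let $\bar H$ be the effective Hamiltonian of the subcritical case, defined in the context. Let $u\in BUSC([0,T]\times\mathbb{R}^n)$ and $v\in BLSC([0,T]\times\mathbb{R}^n)$ be, respectively, a bounded upper semicontinuous viscosity subsolution and a bounded lower semicontinuous viscosity supersolution of $$v_t-\bar H(x,Dv)=0\quad\text{in }(0,T)\times\mathbb{R}^n$$ such that $u(0,x)\le h(x)\le v(0,x)$ for all $x\in\mathbb{R}^n$. Then $u(t,x)\le v(t,x)$ for all $x\in\mathbb{R}^n$ and $0\le t\le T$.
   Context: Standing assumptions: $n,m,r\ge1$ are integers, $T>0$; $\sigma$ from $\mathbb{R}^n\times\mathbb{R}^m$ to the $n\times r$ real matrices is bounded, Lipschitz continuous in $(x,y)$ and $\mathbb{Z}^m$-periodic in $y$; $\tau$ from $\mathbb{R}^m$ to the $m\times r$ real matrices is locally Lipschitz and $\mathbb{Z}^m$-periodic; for some $\theta>0$, $|\tau^T(y)\xi|^2>\theta|\xi|^2$ for all $y\in\mathbb{R}^m$, $\xi\in\mathbb{R}^m\setminus\{0\}$. For $(x,p)\in\mathbb{R}^n\times\mathbb{R}^n$, $\bar H(x,p)$ is the unique constant for which $$\bar H(x,p)-|\tau^T(y)D_yw(y)+\sigma^T(x,y)p|^2=0\quad\text{in }\mathbb{R}^m$$ has a $\mathbb{Z}^m$-periodic viscosity solution $w$. $BC$, $BUSC$, $BLSC$: bounded continuous, bounded upper semicontinuous, bounded lower semicontinuous functions.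
   Formalization: At t = T, u(T,x) ≤ v(T,x) is asserted only at those x where u(T,x) ≤ limsup u(s,y) and v(T,x) ≥ liminf v(s,y) as (s,y)→(T,x), 0<s<T; without this it fails (raise u at t = T only). For 0 ≤ t < T nothing is added. *)

theory Defs
  imports "HOL-Analysis.Analysis"
begin

definition usc_on :: "'a::topological_space set \<Rightarrow> ('a \<Rightarrow> real) \<Rightarrow> bool" where
  "usc_on S f \<longleftrightarrow> (\<forall>z\<in>S. \<forall>c. f z < c \<longrightarrow> (\<forall>\<^sub>F y in at z within S. f y < c))"

definition lsc_on :: "'a::topological_space set \<Rightarrow> ('a \<Rightarrow> real) \<Rightarrow> bool" where
  "lsc_on S f \<longleftrightarrow> (\<forall>z\<in>S. \<forall>c. c < f z \<longrightarrow> (\<forall>\<^sub>F y in at z within S. c < f y))"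

definition BC :: "('a::metric_space \<Rightarrow> real) set" where
  "BC = {f. continuous_on UNIV f \<and> bounded (range f)}"

definition BUSC :: "'a::metric_space set \<Rightarrow> ('a \<Rightarrow> real) set" where
  "BUSC S = {f. usc_on S f \<and> bounded (f ` S)}"

definition BLSC :: "'a::metric_space set \<Rightarrow> ('a \<Rightarrow> real) set" where
  "BLSC S = {f. lsc_on S f \<and> bounded (f ` S)}"

text \<open>The equation is \<open>F(z, Du(z)) = 0\<close> on an open set \<open>\<Omega>\<close>. A test function \<open>\<phi>\<close> of class
  \<open>C\<^sup>1\<close> is given together with its gradient \<open>D\<close>.\<close>

definition C1_test :: "'a::euclidean_space set \<Rightarrow> ('a \<Rightarrow> real) \<Rightarrow> ('a \<Rightarrow> 'a) \<Rightarrow> bool" where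
  "C1_test \<Omega> \<phi> D \<longleftrightarrow> (\<forall>z\<in>\<Omega>. GDERIV \<phi> z :> D z) \<and> continuous_on \<Omega> D"

definition viscosity_subsolution ::
  "'a::euclidean_space set \<Rightarrow> ('a \<Rightarrow> 'a \<Rightarrow> real) \<Rightarrow> ('a \<Rightarrow> real) \<Rightarrow> bool" where
  "viscosity_subsolution \<Omega> F u \<longleftrightarrow> usc_on \<Omega> u \<and>
     (\<forall>\<phi> D. C1_test \<Omega> \<phi> D \<longrightarrow>
       (\<forall>z\<in>\<Omega>. (\<forall>\<^sub>F y in at z within \<Omega>. u y - \<phi> y \<le> u z - \<phi> z) \<longrightarrow> F z (D z) \<le> 0))"

definition viscosity_supersolution ::
  "'a::euclidean_space set \<Rightarrow> ('a \<Rightarrow> 'a \<Rightarrow> real) \<Rightarrow> ('a \<Rightarrow> real) \<Rightarrow> bool" where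
  "viscosity_supersolution \<Omega> F u \<longleftrightarrow> lsc_on \<Omega> u \<and>
     (\<forall>\<phi> D. C1_test \<Omega> \<phi> D \<longrightarrow>
       (\<forall>z\<in>\<Omega>. (\<forall>\<^sub>F y in at z within \<Omega>. u z - \<phi> z \<le> u y - \<phi> y) \<longrightarrow> 0 \<le> F z (D z)))"

text \<open>As sub- and supersolutions are upper and lower semicontinuous, respectively, a viscosity
  solution is continuous on \<open>\<Omega>\<close>.\<close>

definition viscosity_solution ::
  "'a::euclidean_space set \<Rightarrow> ('a \<Rightarrow> 'a \<Rightarrow> real) \<Rightarrow> ('a \<Rightarrow> real) \<Rightarrow> bool" where
  "viscosity_solution \<Omega> F u \<longleftrightarrow> viscosity_subsolution \<Omega> F u \<and> viscosity_supersolution \<Omega> F u"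

definition Z_periodic :: "(real^'m \<Rightarrow> 'b) \<Rightarrow> bool" where
  "Z_periodic f \<longleftrightarrow> (\<forall>y k. (\<forall>i. k $ i \<in> \<int>) \<longrightarrow> f (y + k) = f y)"

definition locally_lipschitz :: "('a::metric_space \<Rightarrow> 'b::metric_space) \<Rightarrow> bool" where
  "locally_lipschitz f \<longleftrightarrow> (\<forall>y. \<exists>e>0. \<exists>L. L-lipschitz_on (cball y e) f)"

text \<open>An \<open>n \<times> r\<close> matrix has type \<^typ>\<open>real^'r^'n\<close> (\<open>n\<close> rows, \<open>r\<close> columns).\<close>

definition cell_operator ::
  "(real^'n \<Rightarrow> real^'m \<Rightarrow> real^'r^'n) \<Rightarrow> (real^'m \<Rightarrow> real^'r^'m) \<Rightarrow>
    real^'n \<Rightarrow> real^'n \<Rightarrow> real \<Rightarrow> real^'m \<Rightarrow> real^'m \<Rightarrow> real" where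
  "cell_operator \<sigma> \<tau> x p c y q =
     c - (norm (transpose (\<tau> y) *v q + transpose (\<sigma> x y) *v p))\<^sup>2"

definition effective_hamiltonian ::
  "(real^'n \<Rightarrow> real^'m \<Rightarrow> real^'r^'n) \<Rightarrow> (real^'m \<Rightarrow> real^'r^'m) \<Rightarrow>
    real^'n \<Rightarrow> real^'n \<Rightarrow> real" where
  "effective_hamiltonian \<sigma> \<tau> x p =
     (THE c. \<exists>w. Z_periodic w \<and> viscosity_solution UNIV (cell_operator \<sigma> \<tau> x p c) w)"

text \<open>The equation \<open>v\<^sub>t - H(x, D v) = 0\<close> on space-time points \<open>(t, x)\<close>; the gradient in \<open>(t, x)\<close> is
  the pair of the time derivative and the spatial gradient.\<close>

definition evolution_operator ::
  "('a \<Rightarrow> 'a \<Rightarrow> real) \<Rightarrow> real \<times> 'a \<Rightarrow> real \<times> 'a \<Rightarrow> real" where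
  "evolution_operator H z P = fst P - H (snd z) (snd P)"

text \<open>An equation imposed on \<open>(0, T)\<close> alone does not control the values at \<open>t = T\<close>: adding a
  positive constant to \<open>u(T, \<cdot>)\<close> only, or subtracting one from \<open>v(T, \<cdot>)\<close> only, preserves
  semicontinuity, boundedness and the viscosity inequalities on \<open>(0, T)\<close>. As is customary, the
  terminal values are therefore understood to be reached from earlier times, that is
  \<open>u(T, x) \<le> limsup u(s, y)\<close> and \<open>v(T, x) \<ge> liminf v(s, y)\<close> for
  \<open>(s, y) \<longrightarrow> (T, x)\<close> with \<open>0 < s < T\<close>. The reverse inequalities hold by semicontinuity.\<close>

definition upper_terminal_value :: "real \<Rightarrow> (real \<times> 'a::metric_space \<Rightarrow> real) \<Rightarrow> 'a \<Rightarrow> bool" where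
  "upper_terminal_value T u x \<longleftrightarrow>
     ereal (u (T, x)) \<le> Limsup (at (T, x) within {0<..<T} \<times> UNIV) (\<lambda>z. ereal (u z))"

definition lower_terminal_value :: "real \<Rightarrow> (real \<times> 'a::metric_space \<Rightarrow> real) \<Rightarrow> 'a \<Rightarrow> bool" where
  "lower_terminal_value T v x \<longleftrightarrow>
     Liminf (at (T, x) within {0<..<T} \<times> UNIV) (\<lambda>z. ereal (v z)) \<le> ereal (v (T, x))"

end

theory Submission
  imports Defs "HOL-Complex_Analysis.Great_Picard"
begin

text \<open>The effective Hamiltonian is quadratic in \<open>p\<close>, and \<open>u\<close> and \<open>v\<close> are merely bounded and
  semicontinuous, so the usual structure condition \<open>\<bar>H(x, p) - H(y, p)\<bar> \<le> \<omega>(\<bar>x - y\<bar> (1 + \<bar>p\<bar>))\<close> of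
  comparison theorems fails. What saves the argument is that \<open>G = sqrt H\<close> satisfies
  \<open>G(x, p) \<le> G(y, p) + L \<bar>x - y\<bar> \<bar>p\<bar>\<close> and is Lipschitz and positively homogeneous in \<open>p\<close>.

  These properties come from the cell problem. The corrector satisfies \<open>\<bar>\<tau>\<^sup>T Dw + \<sigma>\<^sup>T p\<bar> = sqrt c\<close>; if
  \<open>\<sigma>\<^sup>T p\<close> is perturbed by at most \<open>d\<close>, then by the triangle inequality it remains a supersolution with
  \<open>sqrt c + d\<close> in place of \<open>sqrt c\<close>, and comparison of periodic super- and subsolutions (\<open>corrector_comparison\<close>)
  bounds the change of \<open>sqrt c\<close> by \<open>d\<close>. The case \<open>d = 0\<close> is uniqueness of the constant. Existence of
  a corrector (\<open>corrector_exists\<close>) has to be proved as well, for otherwise the definition of the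
  effective Hamiltonian as the unique such constant says nothing. It follows from Perron's method
  for the discounted equations \<open>\<delta> w - \<bar>\<tau>\<^sup>T Dw + \<sigma>\<^sup>T p\<bar>\<^sup>2 = 0\<close> and the limit \<open>\<delta> \<rightarrow> 0\<close>: by
  coercivity, supersolutions are Lipschitz uniformly in \<open>\<delta>\<close> as long as \<open>\<delta> w\<close> is bounded.

  For the evolution equation (\<open>evolution_comparison\<close>) variables are doubled in \<open>u - k v\<close> with \<open>k < 1\<close>.
  By homogeneity \<open>k v\<close> is a supersolution of the equation with Hamiltonian \<open>G\<^sup>2 / k\<close>, and
  \<open>(g + \<delta>)\<^sup>2 \<le> g\<^sup>2 / k + \<delta>\<^sup>2 / (1 - k)\<close> absorbs the error \<open>\<delta>\<close> made in replacing \<open>G(x, p)\<close> by \<open>G(y, q)\<close>,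
  however large the gradients are. The error is small because a logarithmic penalty keeps
  \<open>\<bar>x - y\<bar> \<bar>q\<bar>\<close> small. Since \<open>v\<close> is bounded, \<open>k v\<close> is close to \<open>v\<close>.\<close>

section \<open>Semicontinuous functions\<close>

lemma usc_on_metric:
  fixes f :: "'a::metric_space \<Rightarrow> real"
  shows "usc_on S f \<longleftrightarrow> (\<forall>z\<in>S. \<forall>c>f z. \<exists>d>0. \<forall>y\<in>S. dist y z < d \<longrightarrow> f y < c)"
  unfolding usc_on_def eventually_at by metis

lemma lsc_on_iff_usc_on_uminus: "lsc_on S f \<longleftrightarrow> usc_on S (\<lambda>z. - f z)"
proof -
  have "(\<forall>c. c < f z \<longrightarrow> (\<forall>\<^sub>F y in at z within S. c < f y)) \<longleftrightarrow>
        (\<forall>c. - f z < c \<longrightarrow> (\<forall>\<^sub>F y in at z within S. - f y < c))" (is "(\<forall>c. ?P c) = (\<forall>c. ?Q c)") for z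
  proof -
    have "?Q c = ?P (- c)" "?P c = ?Q (- c)" for c
      by (simp_all add: minus_less_iff)
    then show ?thesis by blast
  qed
  then show ?thesis unfolding usc_on_def lsc_on_def by blast
qed

lemma usc_on_subset: "usc_on S f \<Longrightarrow> R \<subseteq> S \<Longrightarrow> usc_on R (f :: 'a::metric_space \<Rightarrow> real)"
  unfolding usc_on_metric by (meson subset_iff)

lemma continuous_on_imp_usc_on:
  fixes f :: "'a::metric_space \<Rightarrow> real"
  assumes "continuous_on S f"
  shows "usc_on S f"
  unfolding usc_on_def
  using assms by (auto simp: continuous_on_def intro: order_tendstoD(2))

lemma usc_on_add:
  fixes f g :: "'a::metric_space \<Rightarrow> real"
  assumes "usc_on S f" "usc_on S g"
  shows "usc_on S (\<lambda>z. f z + g z)"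
  unfolding usc_on_def
proof (intro ballI allI impI)
  fix z c assume z: "z \<in> S" "f z + g z < c"
  define e where "e = (c - (f z + g z)) / 2"
  have "e > 0" using z by (simp add: e_def)
  then have "\<forall>\<^sub>F y in at z within S. f y < f z + e" "\<forall>\<^sub>F y in at z within S. g y < g z + e"
    using assms z unfolding usc_on_def by auto
  then show "\<forall>\<^sub>F y in at z within S. f y + g y < c"
    by eventually_elim (simp add: e_def field_simps)
qed

lemma usc_on_cmult:
  fixes f :: "'a::metric_space \<Rightarrow> real"
  assumes "usc_on S f" "a > 0"
  shows "usc_on S (\<lambda>z. a * f z)"
  unfolding usc_on_def
proof (intro ballI allI impI)
  fix z c assume z: "z \<in> S" "a * f z < c"
  then have "f z < c / a" using assms(2) by (simp add: field_simps)
  then have "\<forall>\<^sub>F y in at z within S. f y < c / a"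
    using assms z unfolding usc_on_def by auto
  then show "\<forall>\<^sub>F y in at z within S. a * f y < c"
    by eventually_elim (use assms(2) in \<open>simp add: field_simps\<close>)
qed

lemma usc_on_compose:
  fixes f :: "'a::metric_space \<Rightarrow> real" and g :: "'b::metric_space \<Rightarrow> 'a"
  assumes "usc_on S f" "continuous_on R g" "g ` R \<subseteq> S"
  shows "usc_on R (\<lambda>z. f (g z))"
  unfolding usc_on_metric
proof (intro ballI allI impI)
  fix z c assume z: "z \<in> R" "f (g z) < c"
  then obtain d where d: "d > 0" "\<forall>y\<in>S. dist y (g z) < d \<longrightarrow> f y < c"
    using assms(1,3) unfolding usc_on_metric by blast
  obtain d' where "d' > 0" "\<forall>y\<in>R. dist y z < d' \<longrightarrow> dist (g y) (g z) < d"
    using assms(2) z d(1) unfolding continuous_on_iff by blast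
  then show "\<exists>d>0. \<forall>y\<in>R. dist y z < d \<longrightarrow> f (g y) < c"
    using d(2) assms(3) by (metis image_subset_iff)
qed

lemma usc_on_attains_max:
  fixes f :: "'a::metric_space \<Rightarrow> real"
  assumes "compact K" "K \<noteq> {}" "usc_on K f"
  shows "\<exists>z\<in>K. \<forall>y\<in>K. f y \<le> f z"
proof (rule ccontr)
  assume "\<not> ?thesis"
  then have ex: "\<forall>z\<in>K. \<exists>y\<in>K. f z < f y" by (meson not_le)
  \<comment> \<open>Without a maximum the sublevel sets below the values of \<^term>\<open>f\<close> form an open cover; the
     largest of the finitely many values in a subcover is not covered.\<close>
  have "\<forall>z\<in>K. \<exists>U y. open U \<and> z \<in> U \<and> y \<in> K \<and> (\<forall>x\<in>K \<inter> U. f x < f y)"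
  proof
    fix z assume z: "z \<in> K"
    then obtain y where y: "y \<in> K" "f z < f y" using ex by blast
    then obtain d where "d > 0" "\<forall>x\<in>K. dist x z < d \<longrightarrow> f x < f y"
      using assms(3) z unfolding usc_on_metric by blast
    then show "\<exists>U y. open U \<and> z \<in> U \<and> y \<in> K \<and> (\<forall>x\<in>K \<inter> U. f x < f y)"
      using y by (intro exI[of _ "ball z d"] exI[of _ y]) (auto simp: dist_commute)
  qed
  then obtain U Y where UY: "\<And>z. z \<in> K \<Longrightarrow> open (U z) \<and> z \<in> U z \<and> Y z \<in> K \<and> (\<forall>x\<in>K \<inter> U z. f x < f (Y z))"
    by metis
  obtain C where C: "C \<subseteq> K" "finite C" "K \<subseteq> (\<Union>z\<in>C. U z)"
    using compactE_image[OF assms(1), of K U] UY by blast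
  have "C \<noteq> {}" using C(3) assms(2) by auto
  define M where "M = Max ((\<lambda>z. f (Y z)) ` C)"
  have "M \<in> (\<lambda>z. f (Y z)) ` C"
    unfolding M_def using C(2) \<open>C \<noteq> {}\<close> by (intro Max_in) auto
  then obtain z where z: "z \<in> C" "M = f (Y z)" by auto
  have "Y z \<in> K" using z C UY by blast
  then obtain z' where z': "z' \<in> C" "Y z \<in> U z'" using C by blast
  then have "f (Y z) < f (Y z')" using UY[of z'] C \<open>Y z \<in> K\<close> by blast
  moreover have "f (Y z') \<le> M" unfolding M_def using C(2) z' by (intro Max_ge) auto
  ultimately show False using z by simp
qed

lemma usc_on_attains_global_max:
  fixes f :: "'a::metric_space \<Rightarrow> real"
  assumes "compact K" "K \<subseteq> S" "usc_on S f" "a \<in> K"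
    and outside: "\<And>z. z \<in> S \<Longrightarrow> z \<notin> K \<Longrightarrow> f z \<le> f a"
  shows "\<exists>z\<in>K. \<forall>y\<in>S. f y \<le> f z"
proof -
  obtain z where "z \<in> K" "\<forall>y\<in>K. f y \<le> f z"
    using usc_on_attains_max[of K f] assms usc_on_subset by (metis empty_iff)
  then show ?thesis using outside assms(4) by (metis order_trans)
qed

lemma lipschitz_bound_imp_continuous_on:
  fixes w :: "'a::real_normed_vector \<Rightarrow> real"
  assumes "\<And>x y. w x - w y \<le> K * norm (x - y)"
  shows "continuous_on UNIV w"
proof -
  have le: "\<bar>w x - w y\<bar> \<le> \<bar>K\<bar> * norm (x - y)" for x y
  proof -
    have "K * norm (x - y) \<le> \<bar>K\<bar> * norm (x - y)" by (intro mult_right_mono) auto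
    then show ?thesis using assms[of x y] assms[of y x] by (simp add: abs_le_iff norm_minus_commute)
  qed
  have "\<bar>K\<bar>-lipschitz_on UNIV w"
    unfolding lipschitz_on_def dist_norm using le by auto
  then show ?thesis by (rule lipschitz_on_continuous_on)
qed

lemma locally_lipschitz_imp_continuous_on:
  fixes f :: "'a::metric_space \<Rightarrow> 'b::metric_space"
  assumes "locally_lipschitz f"
  shows "continuous_on UNIV f"
proof -
  have "isCont f y" for y
  proof -
    obtain e L where e: "e > 0" "L-lipschitz_on (cball y e) f"
      using assms unfolding locally_lipschitz_def by blast
    have "continuous_on (ball y e) f"
      using lipschitz_on_continuous_on[OF e(2)] by (rule continuous_on_subset) auto
    then show ?thesis using e(1) by (simp add: continuous_on_eq_continuous_at)
  qed
  then show ?thesis by (simp add: continuous_on_eq_continuous_at)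
qed

text \<open>In the application \<open>f(z, z')\<close> is a difference of values at \<open>z\<close> and \<open>z'\<close>, and \<open>C\<close> consists of
  initial points: a bound known on the diagonal extends to pairs of nearby points, with a distance
  that is uniform by compactness.\<close>

lemma usc_on_near_diagonal:
  fixes f :: "'a::metric_space \<times> 'a \<Rightarrow> real"
  assumes f: "usc_on (S \<times> S) f" and C: "compact C" "C \<subseteq> S" "\<And>p. p \<in> C \<Longrightarrow> f (p, p) < c"
  shows "\<exists>\<rho>>0. \<forall>p\<in>C. \<forall>z\<in>S. \<forall>z'\<in>S. dist p z < \<rho> \<longrightarrow> dist p z' < \<rho> \<longrightarrow> f (z, z') < c"
proof -
  define good where "good G \<longleftrightarrow> (\<forall>z\<in>S \<inter> G. \<forall>z'\<in>S \<inter> G. f (z, z') < c)" for G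
  have "\<exists>d>0. good (ball p d)" if p: "p \<in> C" for p
  proof -
    obtain d where d: "d > 0" "\<forall>y\<in>S \<times> S. dist y (p, p) < d \<longrightarrow> f y < c"
      using f C(2,3) p unfolding usc_on_metric by (metis SigmaI subsetD)
    have "dist (z, z') (p, p) < d" if "z \<in> ball p (d / 2)" "z' \<in> ball p (d / 2)" for z z'
    proof -
      have "dist (z, z') (p, p) \<le> dist z p + dist z' p"
        unfolding dist_Pair_Pair by (rule sqrt_sum_squares_le_sum) auto
      also have "\<dots> < d" using that by (simp add: dist_commute)
      finally show ?thesis .
    qed
    then have "good (ball p (d / 2))" using d(2) by (auto simp: good_def)
    then show ?thesis using d(1) half_gt_zero by blast
  qed
  then obtain d where d: "\<And>p. p \<in> C \<Longrightarrow> d p > 0 \<and> good (ball p (d p))" by metis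
  obtain \<rho> where \<rho>: "\<rho> > 0" "\<And>p. p \<in> C \<Longrightarrow> \<exists>G\<in>(\<lambda>p. ball p (d p)) ` C. ball p \<rho> \<subseteq> G"
    by (rule Heine_Borel_lemma[OF C(1), of "(\<lambda>p. ball p (d p)) ` C"]) (use d in auto)
  have "f (z, z') < c" if "p \<in> C" "z \<in> S" "z' \<in> S" "dist p z < \<rho>" "dist p z' < \<rho>"
    for p z z'
  proof -
    have "\<exists>G. good G \<and> ball p \<rho> \<subseteq> G" using \<rho>(2)[OF that(1)] d by blast
    then obtain G where "good G" "ball p \<rho> \<subseteq> G" by blast
    then show ?thesis using that unfolding good_def by (metis IntI mem_ball subsetD)
  qed
  then show ?thesis using \<rho>(1) by blast
qed

section \<open>Viscosity sub- and supersolutions\<close>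

text \<open>Reflection at zero turns every statement about supersolutions into one about subsolutions, so
  the theory below is developed for supersolutions.\<close>

lemma viscosity_subsolution_iff_supersolution:
  "viscosity_subsolution \<Omega> F u \<longleftrightarrow>
   viscosity_supersolution \<Omega> (\<lambda>z q. - F z (- q)) (\<lambda>z. - u z)"
proof -
  have C1: "C1_test \<Omega> (\<lambda>z. - \<phi> z) (\<lambda>z. - D z)" if "C1_test \<Omega> \<phi> D" for \<phi> D
    using that unfolding C1_test_def by (auto intro: GDERIV_minus continuous_on_minus)
  show ?thesis
    unfolding viscosity_subsolution_def viscosity_supersolution_def lsc_on_iff_usc_on_uminus
  proof (intro conj_cong allI iffI ballI impI; (simp; fail)?)
    fix \<phi> D z
    assume H: "\<forall>\<phi> D. C1_test \<Omega> \<phi> D \<longrightarrow>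
       (\<forall>z\<in>\<Omega>. (\<forall>\<^sub>F y in at z within \<Omega>. u y - \<phi> y \<le> u z - \<phi> z) \<longrightarrow> F z (D z) \<le> 0)"
      and C: "C1_test \<Omega> \<phi> D" and z: "z \<in> \<Omega>"
      and ev: "\<forall>\<^sub>F y in at z within \<Omega>. - u z - \<phi> z \<le> - u y - \<phi> y"
    have "\<forall>\<^sub>F y in at z within \<Omega>. u y - (- \<phi> y) \<le> u z - (- \<phi> z)"
      using ev by eventually_elim simp
    then show "0 \<le> - F z (- D z)" using H C1[OF C] z by fastforce
  next
    fix \<phi> D z
    assume H: "\<forall>\<phi> D. C1_test \<Omega> \<phi> D \<longrightarrow>
       (\<forall>z\<in>\<Omega>. (\<forall>\<^sub>F y in at z within \<Omega>. - u z - \<phi> z \<le> - u y - \<phi> y) \<longrightarrow> 0 \<le> - F z (- D z))"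
      and C: "C1_test \<Omega> \<phi> D" and z: "z \<in> \<Omega>"
      and ev: "\<forall>\<^sub>F y in at z within \<Omega>. u y - \<phi> y \<le> u z - \<phi> z"
    have "\<forall>\<^sub>F y in at z within \<Omega>. - u z - (- \<phi> z) \<le> - u y - (- \<phi> y)"
      using ev by eventually_elim simp
    then have "0 \<le> - F z (- (- D z))" using H C1[OF C] z by blast
    then show "F z (D z) \<le> 0" by simp
  qed
qed

lemma viscosity_supersolutionD:
  assumes "viscosity_supersolution \<Omega> F u" "C1_test \<Omega> \<phi> D" "z \<in> \<Omega>"
    and "\<And>y. y \<in> \<Omega> \<Longrightarrow> u z - \<phi> z \<le> u y - \<phi> y"
  shows "0 \<le> F z (D z)"
proof -
  have "\<forall>\<^sub>F y in at z within \<Omega>. u z - \<phi> z \<le> u y - \<phi> y"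
    using assms(4) by (auto simp: eventually_at_filter)
  then show ?thesis using assms(1-3) unfolding viscosity_supersolution_def by blast
qed

lemma viscosity_subsolutionD:
  assumes "viscosity_subsolution \<Omega> F u" "C1_test \<Omega> \<phi> D" "z \<in> \<Omega>"
    and "\<And>y. y \<in> \<Omega> \<Longrightarrow> u y - \<phi> y \<le> u z - \<phi> z"
  shows "F z (D z) \<le> 0"
proof -
  have "\<forall>\<^sub>F y in at z within \<Omega>. u y - \<phi> y \<le> u z - \<phi> z"
    using assms(4) by (auto simp: eventually_at_filter)
  then show ?thesis using assms(1-3) unfolding viscosity_subsolution_def by blast
qed

lemma GDERIV_norm_power2:
  "GDERIV (\<lambda>y. (norm (y - a))\<^sup>2) z :> 2 *\<^sub>R (z - a)"
proof -
  have "((\<lambda>y. (y - a) \<bullet> (y - a)) has_derivative (\<lambda>h. h \<bullet> (2 *\<^sub>R (z - a)))) (at z)"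
    by (auto intro!: derivative_eq_intros simp: algebra_simps inner_commute)
  then show ?thesis unfolding gderiv_def power2_norm_eq_inner .
qed

lemma GDERIV_cmult: "GDERIV f z :> d \<Longrightarrow> GDERIV (\<lambda>y. c * f y) z :> c *\<^sub>R d"
  using GDERIV_mult[OF GDERIV_const, of f z d c] by simp

lemma C1_test_add:
  "C1_test \<Omega> \<phi> D \<Longrightarrow> C1_test \<Omega> \<psi> E \<Longrightarrow> C1_test \<Omega> (\<lambda>y. \<phi> y + \<psi> y) (\<lambda>y. D y + E y)"
  unfolding C1_test_def by (auto intro: GDERIV_add continuous_on_add)

lemma C1_test_cmult: "C1_test \<Omega> \<phi> D \<Longrightarrow> C1_test \<Omega> (\<lambda>y. c * \<phi> y) (\<lambda>y. c *\<^sub>R D y)"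
  unfolding C1_test_def by (auto intro!: GDERIV_cmult continuous_intros)

lemma C1_test_const: "C1_test \<Omega> (\<lambda>y. c) (\<lambda>y. 0)"
  unfolding C1_test_def by (auto intro!: GDERIV_const)

lemma C1_test_norm_power2: "C1_test \<Omega> (\<lambda>y. (norm (y - a))\<^sup>2) (\<lambda>y. 2 *\<^sub>R (y - a))"
  unfolding C1_test_def by (auto intro!: GDERIV_norm_power2 continuous_intros)

lemma C1_test_imp_continuous_on:
  "C1_test \<Omega> \<phi> D \<Longrightarrow> continuous_on \<Omega> \<phi>"
  unfolding C1_test_def gderiv_def
  by (meson continuous_at_imp_continuous_on has_derivative_continuous)

lemma viscosity_supersolution_translate:
  assumes "viscosity_supersolution UNIV F w"
  shows "viscosity_supersolution UNIV (\<lambda>y. F (y + k)) (\<lambda>y. w (y + k))"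
  unfolding viscosity_supersolution_def
proof (intro conjI allI impI ballI)
  have "usc_on UNIV (\<lambda>y. - w y)"
    using assms by (simp add: viscosity_supersolution_def lsc_on_iff_usc_on_uminus)
  then show "lsc_on UNIV (\<lambda>y. w (y + k))"
    unfolding lsc_on_iff_usc_on_uminus
    by (rule usc_on_compose) (auto intro!: continuous_intros)
  fix \<phi> D z
  assume C: "C1_test UNIV \<phi> D" and ev: "\<forall>\<^sub>F y in at z. w (z + k) - \<phi> z \<le> w (y + k) - \<phi> y"
  have "GDERIV (\<lambda>y. \<phi> (y - k)) y :> D (y - k)" for y
  proof -
    have "(\<phi> has_derivative (\<lambda>h. h \<bullet> D (y - k))) (at (y - k))"
      using C by (simp add: C1_test_def gderiv_def)
    moreover have "((\<lambda>y. y - k) has_derivative (\<lambda>h. h)) (at y)"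
      by (auto intro!: derivative_eq_intros)
    ultimately show ?thesis
      unfolding gderiv_def
      using has_derivative_compose[of "\<lambda>y. y - k" "\<lambda>h. h" y UNIV \<phi> "\<lambda>h. h \<bullet> D (y - k)"] by simp
  qed
  moreover have "continuous_on UNIV (\<lambda>y. D (y - k))"
    using C by (auto simp: C1_test_def intro!: continuous_on_compose2[of UNIV D] continuous_intros)
  ultimately have C': "C1_test UNIV (\<lambda>y. \<phi> (y - k)) (\<lambda>y. D (y - k))"
    by (simp add: C1_test_def)
  obtain d where d: "d > 0" "\<And>y. dist y z < d \<Longrightarrow> w (z + k) - \<phi> z \<le> w (y + k) - \<phi> y"
    using ev unfolding eventually_at by (metis UNIV_I order_refl)
  have "\<forall>\<^sub>F y in at (z + k). w (z + k) - \<phi> (z + k - k) \<le> w y - \<phi> (y - k)"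
    unfolding eventually_at
  proof (intro exI[of _ d] conjI ballI impI)
    fix y assume "y \<noteq> z + k \<and> dist y (z + k) < d"
    then show "w (z + k) - \<phi> (z + k - k) \<le> w y - \<phi> (y - k)"
      using d(2)[of "y - k"] by (simp add: dist_norm diff_diff_eq add.commute)
  qed (rule d(1))
  then have "0 \<le> F (z + k) (D (z + k - k))"
    using assms C' unfolding viscosity_supersolution_def by blast
  then show "0 \<le> F (z + k) (D z)" by simp
qed

lemma viscosity_supersolution_scale:
  assumes "viscosity_supersolution \<Omega> F w" "k > 0"
  shows "viscosity_supersolution \<Omega> (\<lambda>y q. F y ((1 / k) *\<^sub>R q)) (\<lambda>y. k * w y)"
  unfolding viscosity_supersolution_def
proof (intro conjI allI impI ballI)
  have "usc_on \<Omega> (\<lambda>y. k * (- w y))"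
    using assms by (intro usc_on_cmult)
      (simp_all add: viscosity_supersolution_def lsc_on_iff_usc_on_uminus)
  then show "lsc_on \<Omega> (\<lambda>y. k * w y)"
    by (simp add: lsc_on_iff_usc_on_uminus)
  fix \<phi> D z
  assume C: "C1_test \<Omega> \<phi> D" and z: "z \<in> \<Omega>"
    and ev: "\<forall>\<^sub>F y in at z within \<Omega>. k * w z - \<phi> z \<le> k * w y - \<phi> y"
  have "\<forall>\<^sub>F y in at z within \<Omega>. w z - (1 / k) * \<phi> z \<le> w y - (1 / k) * \<phi> y"
    using ev
  proof eventually_elim
    case (elim y)
    have "(k * w z - \<phi> z) / k \<le> (k * w y - \<phi> y) / k"
      using elim assms(2) by (intro divide_right_mono) auto
    then show ?case using assms(2) by (simp add: diff_divide_distrib)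
  qed
  then show "0 \<le> F z ((1 / k) *\<^sub>R D z)"
    using assms C1_test_cmult[OF C] z unfolding viscosity_supersolution_def by blast
qed

lemma viscosity_subsolution_scale:
  assumes "viscosity_subsolution \<Omega> F w" "k > 0"
  shows "viscosity_subsolution \<Omega> (\<lambda>y q. F y ((1 / k) *\<^sub>R q)) (\<lambda>y. k * w y)"
  using viscosity_supersolution_scale[of \<Omega> "\<lambda>z q. - F z (- q)" "\<lambda>z. - w z" k] assms
  by (simp add: viscosity_subsolution_iff_supersolution)

lemma viscosity_supersolution_add_const:
  assumes "viscosity_supersolution \<Omega> F u"
  shows "viscosity_supersolution \<Omega> F (\<lambda>y. u y + c)"
proof -
  have "usc_on \<Omega> (\<lambda>y. - u y + - c)"
    using assms by (intro usc_on_add continuous_on_imp_usc_on[OF continuous_on_const])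
      (simp add: viscosity_supersolution_def lsc_on_iff_usc_on_uminus)
  then show ?thesis
    using assms by (auto simp: viscosity_supersolution_def lsc_on_iff_usc_on_uminus algebra_simps)
qed

lemma viscosity_supersolution_mono:
  assumes "viscosity_supersolution \<Omega> F u" "\<And>z q. 0 \<le> F z q \<Longrightarrow> 0 \<le> F' z q"
  shows "viscosity_supersolution \<Omega> F' u"
  using assms unfolding viscosity_supersolution_def by blast

lemma viscosity_subsolution_mono:
  assumes "viscosity_subsolution \<Omega> F u" "\<And>z q. F z q \<le> 0 \<Longrightarrow> F' z q \<le> 0"
  shows "viscosity_subsolution \<Omega> F' u"
  using assms unfolding viscosity_subsolution_def by blast

lemma C1_test_touching_gradient:
  assumes "C1_test UNIV \<psi> E" "C1_test UNIV \<phi> D" "\<forall>\<^sub>F y in at z. \<psi> z - \<phi> z \<le> \<psi> y - \<phi> y"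
  shows "E z = D z"
proof -
  have "GDERIV (\<lambda>y. \<psi> y - \<phi> y) z :> E z - D z"
    using assms unfolding C1_test_def by (auto intro: GDERIV_diff)
  then have "(\<lambda>h. h \<bullet> (E z - D z)) = (\<lambda>h. 0)"
    unfolding gderiv_def using has_derivative_local_min assms(3) by blast
  then have "(E z - D z) \<bullet> (E z - D z) = 0" by meson
  then show ?thesis by simp
qed

text \<open>Penalising with a paraboloid moves the minimum of a function that nearly satisfies the
  assumptions of a minimum at the centre only a little; this replaces the usual reduction to strict
  minima and keeps track of the sizes.\<close>

lemma penalized_min_near:
  fixes f :: "'a::euclidean_space \<Rightarrow> real"
  assumes "lsc_on UNIV f" "0 \<le> r" "0 \<le> e" "2 * e < r\<^sup>2"
    and lower: "\<And>y. y \<in> cball z r \<Longrightarrow> m - e \<le> f y"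
    and centre: "f z \<le> m + e"
  shows "\<exists>y. (norm (y - z))\<^sup>2 \<le> 2 * e \<and> m - e \<le> f y \<and> f y \<le> m + e \<and>
    (\<forall>\<^sub>F x in at y. f y + (norm (y - z))\<^sup>2 \<le> f x + (norm (x - z))\<^sup>2)"
proof -
  define g where "g = (\<lambda>y. f y + (norm (y - z))\<^sup>2)"
  have "usc_on (cball z r) (\<lambda>y. - f y + - (norm (y - z))\<^sup>2)"
    using assms(1) unfolding lsc_on_iff_usc_on_uminus
    by (intro usc_on_add[OF _ continuous_on_imp_usc_on])
      (auto intro: usc_on_subset intro!: continuous_intros)
  then have "usc_on (cball z r) (\<lambda>y. - g y)" by (simp add: g_def)
  then obtain y where y: "y \<in> cball z r" "\<And>x. x \<in> cball z r \<Longrightarrow> g y \<le> g x"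
    using usc_on_attains_max[of "cball z r" "\<lambda>y. - g y"] assms(2) by auto
  have le: "f y + (norm (y - z))\<^sup>2 \<le> m + e"
    using y(2)[of z] assms(2) centre by (simp add: g_def)
  have small: "(norm (y - z))\<^sup>2 \<le> 2 * e" using le lower[OF y(1)] by simp
  then have "(norm (y - z))\<^sup>2 < r\<^sup>2" using assms(4) by simp
  then have "norm (y - z) < r" using assms(2) by (rule power2_less_imp_less)
  then have "y \<in> ball z r" by (simp add: dist_norm norm_minus_commute)
  then have "\<forall>\<^sub>F x in at y. x \<in> ball z r"
    by (intro eventually_at_in_open') auto
  then have "\<forall>\<^sub>F x in at y. g y \<le> g x"
    by eventually_elim (use y(2) in auto)
  moreover have "f y \<le> m + e" using le zero_le_power2[of "norm (y - z)"] by linarith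
  ultimately show ?thesis using small lower[OF y(1)] unfolding g_def by blast
qed

text \<open>A function is a supersolution if near each point it can be approximated by supersolutions of
  nearby equations. The approximation is one-sided except at the point itself; thus the lemma serves
  both for infima of families, where the approximants lie above, and for locally uniform limits. The
  zeroth order term is allowed in the equation because discounted problems are approximated too.\<close>

lemma viscosity_supersolution_stable:
  fixes w :: "'a::euclidean_space \<Rightarrow> real" and N :: "'a \<Rightarrow> 'a \<Rightarrow> real"
  assumes N: "continuous_on UNIV (\<lambda>(y, q). N y q)" and w: "lsc_on UNIV w"
    and approx: "\<And>z r e. 0 < r \<Longrightarrow> 0 < e \<Longrightarrow> \<exists>a' d' w'.
      viscosity_supersolution UNIV (\<lambda>y q. a' + d' * w' y - N y q) w' \<and>
      \<bar>a' - a\<bar> \<le> e \<and> \<bar>d' - d\<bar> \<le> e \<and> (\<forall>y\<in>cball z r. w y - e \<le> w' y) \<and> w' z \<le> w z + e"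
  shows "viscosity_supersolution UNIV (\<lambda>y q. a + d * w y - N y q) w"
  unfolding viscosity_supersolution_def
proof (intro conjI allI impI ballI)
  fix \<phi> D z
  assume C: "C1_test UNIV \<phi> D" and ev: "\<forall>\<^sub>F y in at z. w z - \<phi> z \<le> w y - \<phi> y"
  obtain r0 where r0: "r0 > 0" "\<And>y. dist y z < r0 \<Longrightarrow> w z - \<phi> z \<le> w y - \<phi> y"
    using ev unfolding eventually_at by (metis UNIV_I order_refl)
  define r where "r = r0 / 2"
  have r: "r > 0" "\<And>y. y \<in> cball z r \<Longrightarrow> w z - \<phi> z \<le> w y - \<phi> y"
    using r0 by (auto simp: r_def dist_commute)
  define e where "e k = r\<^sup>2 / 4 * (1 / real (Suc k))" for k
  have e0: "e k > 0" for k using r by (simp add: e_def)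
  have er: "2 * e k < r\<^sup>2" for k
  proof -
    have "1 / real (Suc k) \<le> 1" by simp
    then have "e k \<le> r\<^sup>2 / 4 * 1" unfolding e_def by (intro mult_left_mono) auto
    moreover have "r\<^sup>2 > 0" using r(1) by simp
    ultimately show ?thesis by linarith
  qed
  have e_lim: "e \<longlonglongrightarrow> 0"
    unfolding e_def inverse_eq_divide[symmetric]
    by (rule tendsto_mult_right_zero[OF LIMSEQ_inverse_real_of_nat])
  have "\<exists>a' d' w' y. \<bar>a' - a\<bar> \<le> e k \<and> \<bar>d' - d\<bar> \<le> e k \<and> (norm (y - z))\<^sup>2 \<le> 2 * e k \<and>
      \<bar>w' - \<phi> y - (w z - \<phi> z)\<bar> \<le> e k \<and> 0 \<le> a' + d' * w' - N y (D y - 2 *\<^sub>R (y - z))" for k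
  proof -
    obtain a' d' w' where A: "viscosity_supersolution UNIV (\<lambda>y q. a' + d' * w' y - N y q) w'"
      "\<bar>a' - a\<bar> \<le> e k" "\<bar>d' - d\<bar> \<le> e k" "\<forall>y\<in>cball z r. w y - e k \<le> w' y" "w' z \<le> w z + e k"
      using approx[OF r(1) e0] by blast
    have "usc_on UNIV (\<lambda>y. - w' y + \<phi> y)"
      using A(1) by (intro usc_on_add[OF _ continuous_on_imp_usc_on] C1_test_imp_continuous_on[OF C])
        (simp_all add: viscosity_supersolution_def lsc_on_iff_usc_on_uminus)
    then have lsc: "lsc_on UNIV (\<lambda>y. w' y - \<phi> y)"
      by (simp add: lsc_on_iff_usc_on_uminus algebra_simps)
    have "w z - \<phi> z - e k \<le> w' y - \<phi> y" if "y \<in> cball z r" for y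
      using A(4) r(2)[OF that] that by fastforce
    moreover have "w' z - \<phi> z \<le> w z - \<phi> z + e k" using A(5) by simp
    ultimately obtain y where y: "(norm (y - z))\<^sup>2 \<le> 2 * e k"
      "w z - \<phi> z - e k \<le> w' y - \<phi> y" "w' y - \<phi> y \<le> w z - \<phi> z + e k"
      "\<forall>\<^sub>F x in at y. w' y - \<phi> y + (norm (y - z))\<^sup>2 \<le> w' x - \<phi> x + (norm (x - z))\<^sup>2"
      using penalized_min_near[OF lsc less_imp_le[OF r(1)] less_imp_le[OF e0] er] by blast
    have C': "C1_test UNIV (\<lambda>x. \<phi> x + (-1) * (norm (x - z))\<^sup>2) (\<lambda>x. D x + (-1) *\<^sub>R (2 *\<^sub>R (x - z)))"
      by (intro C1_test_add C C1_test_cmult C1_test_norm_power2)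
    have "\<forall>\<^sub>F x in at y. w' y - (\<phi> y + (-1) * (norm (y - z))\<^sup>2) \<le> w' x - (\<phi> x + (-1) * (norm (x - z))\<^sup>2)"
      using y(4) by eventually_elim simp
    then have "0 \<le> a' + d' * w' y - N y (D y + (-1) *\<^sub>R (2 *\<^sub>R (y - z)))"
      using A(1) C' unfolding viscosity_supersolution_def by blast
    then show ?thesis using A y
      by (intro exI[of _ a'] exI[of _ d'] exI[of _ "w' y"] exI[of _ y]) auto
  qed
  then obtain a' d' w' y where seq:
    "\<And>k. \<bar>a' k - a\<bar> \<le> e k" "\<And>k. \<bar>d' k - d\<bar> \<le> e k" "\<And>k. (norm (y k - z))\<^sup>2 \<le> 2 * e k"
    "\<And>k. \<bar>w' k - \<phi> (y k) - (w z - \<phi> z)\<bar> \<le> e k"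
    "\<And>k. 0 \<le> a' k + d' k * w' k - N (y k) (D (y k) - 2 *\<^sub>R (y k - z))"
    by metis
  have squeeze: "f \<longlonglongrightarrow> l" if "\<And>k. \<bar>f k - l\<bar> \<le> e k" for f l
    using that by (intro LIM_zero_cancel[OF Lim_null_comparison[OF _ e_lim]]) simp
  have "(\<lambda>k. (norm (y k - z))\<^sup>2) \<longlonglongrightarrow> 0"
    by (rule Lim_null_comparison[OF _ tendsto_mult_right_zero[OF e_lim, of 2]]) (use seq(3) in simp)
  then have "(\<lambda>k. norm (y k - z)) \<longlonglongrightarrow> 0"
    using tendsto_real_sqrt[of "\<lambda>k. (norm (y k - z))\<^sup>2" 0] by simp
  then have y: "y \<longlonglongrightarrow> z" using LIM_zero_cancel tendsto_norm_zero_iff by blast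
  have \<phi>: "(\<lambda>k. \<phi> (y k)) \<longlonglongrightarrow> \<phi> z"
    using C1_test_imp_continuous_on[OF C] y by (rule continuous_on_tendsto_compose) auto
  have Dy: "(\<lambda>k. D (y k)) \<longlonglongrightarrow> D z"
    using C y unfolding C1_test_def
    by(blast intro: continuous_on_tendsto_compose[of UNIV D] eventuallyI)
  have "(\<lambda>k. w' k - \<phi> (y k) + \<phi> (y k)) \<longlonglongrightarrow> w z - \<phi> z + \<phi> z"
    by (intro tendsto_add squeeze seq \<phi>)
  then have w': "w' \<longlonglongrightarrow> w z" by simp
  have "(\<lambda>k. D (y k) - 2 *\<^sub>R (y k - z)) \<longlonglongrightarrow> D z - 2 *\<^sub>R (z - z)"
    by (intro tendsto_intros Dy y)
  then have "(\<lambda>k. (y k, D (y k) - 2 *\<^sub>R (y k - z))) \<longlonglongrightarrow> (z, D z)"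
    using y by (intro tendsto_Pair) auto
  then have "(\<lambda>k. (case (y k, D (y k) - 2 *\<^sub>R (y k - z)) of (y, q) \<Rightarrow> N y q)) \<longlonglongrightarrow>
      (case (z, D z) of (y, q) \<Rightarrow> N y q)"
    by (rule continuous_on_tendsto_compose[OF N]) auto
  then have "(\<lambda>k. a' k + d' k * w' k - N (y k) (D (y k) - 2 *\<^sub>R (y k - z))) \<longlonglongrightarrow> a + d * w z - N z (D z)"
    using tendsto_diff[OF tendsto_add[OF squeeze[OF seq(1)] tendsto_mult[OF squeeze[OF seq(2)] w']]]
    by simp
  then show "0 \<le> a + d * w z - N z (D z)"
    by (rule LIMSEQ_le_const) (use seq in auto)
qed (rule w)

text \<open>An eikonal bound on the gradients of test functions is a Lipschitz bound: the cone
  \<open>w(x) - k \<bar>y - x\<bar>\<close> with \<open>k > K\<close>, lowered until it touches, can touch only at its vertex. Away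
  from the vertex the cone is replaced by the paraboloid that is tangent to it on the sphere through
  the touching point, because a test function has to be smooth everywhere.\<close>

lemma viscosity_supersolution_lipschitz:
  fixes w :: "'a::euclidean_space \<Rightarrow> real"
  assumes w: "viscosity_supersolution UNIV F w" and B: "\<And>z. B \<le> w z"
    and K0: "0 \<le> K" and K: "\<And>z q. 0 \<le> F z q \<Longrightarrow> norm q \<le> K"
  shows "w x - w y \<le> K * norm (x - y)"
proof -
  have *: "w x \<le> w y + k * norm (y - x)" if k: "K < k" "0 < k" for k
  proof -
    define R where "R = (w x - B) / k"
    have R: "R \<ge> 0" using B[of x] k by (simp add: R_def)
    define f where "f = (\<lambda>y. - w y + - (k * norm (y - x)))"
    have "usc_on UNIV f"
      unfolding f_def using w
      by (intro usc_on_add[OF _ continuous_on_imp_usc_on])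
        (auto simp: viscosity_supersolution_def lsc_on_iff_usc_on_uminus intro!: continuous_intros)
    moreover have "f z \<le> f x" if "z \<notin> cball x R" for z
    proof -
      have "norm (z - x) \<ge> R" using that by (simp add: dist_norm norm_minus_commute)
      then have "k * R \<le> k * norm (z - x)" using k by simp
      then show ?thesis using B[of z] k by (simp add: f_def R_def)
    qed
    ultimately obtain z where z: "\<And>y. f y \<le> f z"
      using usc_on_attains_global_max[of "cball x R" UNIV f x] R by auto
    have "z = x"
    proof (rule ccontr)
      assume "z \<noteq> x"
      define \<rho> where "\<rho> = norm (z - x)"
      have \<rho>: "\<rho> > 0" using \<open>z \<noteq> x\<close> by (simp add: \<rho>_def)
      define c where "c = - k / (2 * \<rho>)"
      have "w z - c * (norm (z - x))\<^sup>2 \<le> w y - c * (norm (y - x))\<^sup>2" for y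
      proof -
        have "0 \<le> (norm (y - x) - \<rho>)\<^sup>2 * (k / (2 * \<rho>))" using k \<rho> by simp
        also have "\<dots> = - c * (norm (y - x))\<^sup>2 - k * norm (y - x) + k * \<rho> / 2"
          using \<rho> by (simp add: c_def field_simps power2_eq_square)
        finally have "k * norm (y - x) \<le> - c * (norm (y - x))\<^sup>2 + k * \<rho> / 2" by simp
        moreover have "- c * (norm (z - x))\<^sup>2 = k * \<rho> / 2"
          using \<rho> by (simp add: c_def \<rho>_def[symmetric] power2_eq_square)
        moreover have "w z + k * \<rho> \<le> w y + k * norm (y - x)"
          using z[of y] by (simp add: f_def \<rho>_def)
        ultimately show ?thesis by (simp add: field_simps)
      qed
      then have "0 \<le> F z (c *\<^sub>R (2 *\<^sub>R (z - x)))"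
        by (intro viscosity_supersolutionD[OF w C1_test_cmult[OF C1_test_norm_power2]]) auto
      then have "norm (c *\<^sub>R (2 *\<^sub>R (z - x))) \<le> K" by (rule K)
      moreover have "norm (c *\<^sub>R (2 *\<^sub>R (z - x))) = \<bar>c\<bar> * (2 * \<rho>)"
        by (simp add: \<rho>_def abs_mult)
      ultimately show False using k \<rho> by (simp add: c_def)
    qed
    then show ?thesis using z[of y] by (simp add: f_def)
  qed
  have "w x - w y \<le> K * norm (x - y) + e" if e: "e > 0" for e
  proof -
    define k where "k = K + e / (norm (x - y) + 1)"
    have pos: "norm (x - y) + 1 > 0" by (simp add: add_nonneg_pos)
    then have "K < k" using e by (simp add: k_def)
    then have "w x - w y \<le> k * norm (x - y)"
      using *[of k] K0 by (simp add: norm_minus_commute)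
    also have "\<dots> = K * norm (x - y) + e * (norm (x - y) / (norm (x - y) + 1))"
      by (simp add: k_def algebra_simps)
    also have "\<dots> \<le> K * norm (x - y) + e * 1"
      using pos e by (intro add_left_mono mult_left_mono) auto
    finally show ?thesis by simp
  qed
  then show ?thesis by (rule field_le_epsilon)
qed

section \<open>The cell problem\<close>

lemma cube_representative:
  fixes y :: "real^'m"
  shows "\<exists>k. (\<forall>i. k $ i \<in> \<int>) \<and> y + k \<in> cbox 0 1"
proof (intro exI conjI)
  define k :: "real^'m" where "k = (\<chi> i. - of_int \<lfloor>y $ i\<rfloor>)"
  show "\<forall>i. k $ i \<in> \<int>" by (simp add: k_def)
  have "0 \<le> y $ i - of_int \<lfloor>y $ i\<rfloor> \<and> y $ i - of_int \<lfloor>y $ i\<rfloor> \<le> 1" for i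
    by linarith
  then show "y + k \<in> cbox 0 1" by (simp add: mem_box_cart k_def)
qed

lemma Z_periodic_attains_max:
  assumes "Z_periodic f" "usc_on UNIV f"
  shows "\<exists>z. \<forall>y. f y \<le> f z"
proof -
  have "(0::real^'b) \<in> cbox 0 1" by (simp add: mem_box_cart)
  then obtain z where z: "\<forall>y\<in>cbox 0 1. f y \<le> f z"
    using usc_on_attains_max[of "cbox 0 1" f] usc_on_subset[OF assms(2)]
    by(metis compact_cbox empty_iff subset_UNIV)
  have "f y \<le> f z" for y
    using cube_representative[of y] z assms(1) unfolding Z_periodic_def by metis
  then show ?thesis by blast
qed

lemma Z_periodic_continuous_bounded:
  fixes f :: "real^'m \<Rightarrow> 'b::real_normed_vector"
  assumes "Z_periodic f" "continuous_on UNIV f"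
  shows "\<exists>C\<ge>0. \<forall>y. norm (f y) \<le> C"
proof -
  have "usc_on UNIV (\<lambda>y. norm (f y))"
    using assms(2) by (intro continuous_on_imp_usc_on continuous_intros)
  moreover have "Z_periodic (\<lambda>y. norm (f y))" using assms(1) by (simp add: Z_periodic_def)
  ultimately obtain z where "\<forall>y. norm (f y) \<le> norm (f z)"
    using Z_periodic_attains_max by blast
  then show ?thesis by (intro exI[of _ "norm (f z)"]) auto
qed

lemma bounded_bilinear_transpose_matrix_vector:
  "bounded_bilinear (\<lambda>(A :: real^'r^'m) q. transpose A *v q)"
proof -
  have "bilinear (\<lambda>(A :: real^'r^'m) q. transpose A *v q)"
    unfolding bilinear_def
    by (auto intro!: linearI simp: vec_eq_iff matrix_vector_mult_def transpose_def
        sum.distrib algebra_simps sum_distrib_left)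
  then show ?thesis by (simp add: bilinear_conv_bounded_bilinear)
qed

locale coercive_cell =
  fixes \<tau> :: "real^'m \<Rightarrow> real^'r^'m" and \<theta> :: real
  assumes \<tau>_cont: "continuous_on UNIV \<tau>" and \<tau>_per: "Z_periodic \<tau>" and \<theta>_pos: "\<theta> > 0"
    and coercive: "\<theta> * (norm q)\<^sup>2 \<le> (norm (transpose (\<tau> y) *v q))\<^sup>2"
begin

text \<open>The cell equation reads \<open>c - Ham s y (Dw) = 0\<close> with \<open>s = \<sigma>(x, \<cdot>)\<^sup>T p\<close>. Its supersolutions are the
  functions with \<open>\<bar>\<tau>\<^sup>T Dw + s\<bar>\<^sup>2 \<le> c\<close> in the viscosity sense; coercivity controls these, and not the
  subsolutions.\<close>

definition Ham :: "(real^'m \<Rightarrow> real^'r) \<Rightarrow> real^'m \<Rightarrow> real^'m \<Rightarrow> real" where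
  "Ham s y q = (norm (transpose (\<tau> y) *v q + s y))\<^sup>2"

lemma Ham_le_imp_gradient_bound:
  assumes "Ham s y q \<le> C\<^sup>2" "0 \<le> C"
  shows "norm q \<le> (C + norm (s y)) / sqrt \<theta>"
proof -
  have "norm (transpose (\<tau> y) *v q + s y) \<le> C"
    using assms unfolding Ham_def by (rule power2_le_imp_le)
  then have "norm (transpose (\<tau> y) *v q) \<le> C + norm (s y)"
    using norm_triangle_ineq4[of "transpose (\<tau> y) *v q + s y" "s y"] by simp
  moreover have "sqrt \<theta> * norm q \<le> norm (transpose (\<tau> y) *v q)"
  proof (rule power2_le_imp_le[OF _ norm_ge_zero])
    show "(sqrt \<theta> * norm q)\<^sup>2 \<le> (norm (transpose (\<tau> y) *v q))\<^sup>2"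
      using \<theta>_pos coercive[of q y] by (simp only: power_mult_distrib real_sqrt_pow2 less_imp_le)
  qed
  ultimately show ?thesis using \<theta>_pos by (simp add: field_simps)
qed

lemma continuous_on_Ham:
  assumes "continuous_on UNIV s"
  shows "continuous_on UNIV (\<lambda>(y, q). Ham s y q)"
proof -
  have "continuous_on UNIV (\<lambda>z. transpose (\<tau> (fst z)) *v snd z)"
    by (intro bounded_bilinear.continuous_on[OF bounded_bilinear_transpose_matrix_vector]
        continuous_on_compose2[OF \<tau>_cont] continuous_intros) auto
  moreover have "continuous_on UNIV (\<lambda>z. s (fst z))"
    by (intro continuous_on_compose2[OF assms] continuous_intros) auto
  ultimately show ?thesis
    unfolding Ham_def case_prod_unfold
    by(rule continuous_on_power[OF continuous_on_norm[OF continuous_on_add]])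
qed

lemma continuous_on_Ham_compose:
  assumes "continuous_on UNIV s" "continuous_on UNIV E"
  shows "continuous_on UNIV (\<lambda>y. Ham s y (E y))"
proof -
  have "continuous_on UNIV (\<lambda>y. (y, E y))" by (intro continuous_intros assms(2))
  from continuous_on_compose2[OF continuous_on_Ham[OF assms(1)] this] show ?thesis by simp
qed

text \<open>Doubling of variables. The quadratic penalisation may be as strong as desired, since the
  supersolution property bounds its gradient at the maximum by coercivity; the two points are
  therefore so close that \<open>\<tau>\<close> and \<open>s\<^sub>1\<close> hardly differ between them. Periodicity provides the
  maximum.\<close>

lemma corrector_comparison:
  assumes s: "continuous_on UNIV s\<^sub>1"
    and w1: "Z_periodic w\<^sub>1" "viscosity_supersolution UNIV (\<lambda>y q. c\<^sub>1 - Ham s\<^sub>1 y q) w\<^sub>1"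
    and w2: "Z_periodic w\<^sub>2" "viscosity_subsolution UNIV (\<lambda>y q. c\<^sub>2 - Ham s\<^sub>2 y q) w\<^sub>2"
    and d: "\<And>y. norm (s\<^sub>1 y - s\<^sub>2 y) \<le> d"
  shows "sqrt c\<^sub>2 \<le> sqrt c\<^sub>1 + d"
proof -
  have u1: "usc_on UNIV (\<lambda>y. - w\<^sub>1 y)" and u2: "usc_on UNIV w\<^sub>2"
    using w1(2) w2(2) by (auto simp: viscosity_supersolution_def viscosity_subsolution_def
        lsc_on_iff_usc_on_uminus)
  obtain z1 where z1: "\<And>y. - w\<^sub>1 y \<le> - w\<^sub>1 z1"
    using Z_periodic_attains_max[OF _ u1] w1(1) unfolding Z_periodic_def by auto
  obtain z2 where z2: "\<And>y. w\<^sub>2 y \<le> w\<^sub>2 z2"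
    using Z_periodic_attains_max[OF w2(1) u2] by blast
  define osc where "osc = w\<^sub>2 z2 - w\<^sub>1 z1 - (w\<^sub>2 0 - w\<^sub>1 0)"
  have osc: "osc \<ge> 0" using z1[of 0] z2[of 0] by (simp add: osc_def)
  obtain m where m: "\<And>x :: real^'m. x \<in> cbox 0 1 \<Longrightarrow> norm x \<le> m"
    using bounded_cbox[of 0 1] unfolding bounded_iff by blast
  have zero: "(0 :: real^'m) \<in> cbox 0 1" by (simp add: mem_box_cart)
  then have m0: "m \<ge> 0" using m by force
  \<comment> \<open>Beyond this radius the penalty, already for \<open>k = 1\<close>, outweighs the oscillation of both
     functions.\<close>
  define R where "R = m + sqrt (2 * osc)"
  have mR: "m \<le> R" using osc by (simp add: R_def)
  have "\<exists>x\<in>cball 0 R. \<exists>y\<in>cball 0 R.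
      Ham s\<^sub>1 y (k *\<^sub>R (x - y)) \<le> c\<^sub>1 \<and> c\<^sub>2 \<le> Ham s\<^sub>2 x (k *\<^sub>R (x - y))" if k: "k \<ge> 1" for k :: real
  proof -
    define f where "f z = w\<^sub>2 (fst z) + - w\<^sub>1 (snd z) + - (k / 2 * (norm (fst z - snd z))\<^sup>2)" for z
    have "usc_on UNIV f"
      unfolding f_def
      by (intro usc_on_add usc_on_compose[OF u2] usc_on_compose[OF u1] continuous_on_imp_usc_on
          continuous_intros) auto
    then have uscf: "usc_on (cbox 0 1 \<times> UNIV) f" using usc_on_subset by blast
    have out: "f z \<le> f (0, 0)" if z: "z \<in> cbox 0 1 \<times> UNIV" "z \<notin> cbox 0 1 \<times> cball 0 R" for z
    proof -
      obtain x y where xy: "z = (x, y)" by fastforce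
      have "norm x \<le> m" "norm y \<ge> R" using z m by (auto simp: xy)
      then have "sqrt (2 * osc) \<le> norm (x - y)"
        using norm_triangle_ineq2[of y x] by (simp add: R_def norm_minus_commute)
      then have "(sqrt (2 * osc))\<^sup>2 \<le> (norm (x - y))\<^sup>2"
        using osc by (intro power_mono) auto
      then have "2 * osc \<le> (norm (x - y))\<^sup>2" using osc by simp
      also have "\<dots> \<le> k * (norm (x - y))\<^sup>2" using mult_right_mono[OF k, of "(norm (x - y))\<^sup>2"] by simp
      finally show ?thesis using z1[of y] z2[of x] by (simp add: f_def xy osc_def)
    qed
    have "\<exists>z\<in>cbox 0 1 \<times> cball 0 R. \<forall>v\<in>cbox 0 1 \<times> UNIV. f v \<le> f z"
    proof (rule usc_on_attains_global_max[OF _ _ uscf _ out])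
      show "compact (cbox 0 1 \<times> cball 0 R :: ((real^'m) \<times> (real^'m)) set)"
        by (intro compact_Times compact_cbox compact_cball)
      show "(0, 0) \<in> (cbox 0 1 \<times> cball 0 R :: ((real^'m) \<times> (real^'m)) set)" using zero mR m0 by simp
    qed auto
    then obtain z where z: "z \<in> cbox 0 1 \<times> cball 0 R" "\<forall>v\<in>cbox 0 1 \<times> UNIV. f v \<le> f z"
      by blast
    obtain x y where xy: "z = (x, y)" by fastforce
    have fmax: "f (x', y') \<le> f (x, y)" for x' y'
    proof -
      obtain j where j: "\<forall>i. j $ i \<in> \<int>" "x' + j \<in> cbox 0 1"
        using cube_representative by blast
      have "f (x', y') = f (x' + j, y' + j)"
        using w1(1) w2(1) j(1) by (simp add: f_def Z_periodic_def)
      also have "\<dots> \<le> f (x, y)" using z(2) j(2) xy by blast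
      finally show ?thesis .
    qed
    have "c\<^sub>2 - Ham s\<^sub>2 x ((k / 2) *\<^sub>R (2 *\<^sub>R (x - y))) \<le> 0"
      by (rule viscosity_subsolutionD[OF w2(2) C1_test_cmult[OF C1_test_norm_power2]])
        (use fmax[of _ y] in \<open>auto simp: f_def algebra_simps\<close>)
    moreover have "0 \<le> c\<^sub>1 - Ham s\<^sub>1 y ((- k / 2) *\<^sub>R (2 *\<^sub>R (y - x)))"
      by (rule viscosity_supersolutionD[OF w1(2) C1_test_cmult[OF C1_test_norm_power2]])
        (use fmax[of x] in \<open>auto simp: f_def algebra_simps norm_minus_commute\<close>)
    moreover have "(- k / 2) *\<^sub>R (2 *\<^sub>R (y - x)) = k *\<^sub>R (x - y)"
      by (simp add: algebra_simps)
    moreover have "x \<in> cball 0 R" "y \<in> cball 0 R" using z(1) m mR by (force simp: xy)+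
    ultimately show ?thesis by force
  qed
  note pts = this
  have c1: "c\<^sub>1 \<ge> 0"
  proof -
    obtain x y where "Ham s\<^sub>1 y (1 *\<^sub>R (x - y)) \<le> c\<^sub>1" using pts[of 1] by auto
    then show ?thesis unfolding Ham_def by (rule order_trans[OF zero_le_power2])
  qed
  obtain M where M: "\<And>y. y \<in> cball 0 R \<Longrightarrow> norm (s\<^sub>1 y) \<le> M"
    using compact_imp_bounded[OF compact_continuous_image[OF continuous_on_subset[OF s] compact_cball]]
    unfolding bounded_iff by (metis imageI subset_UNIV)
  have M0: "M \<ge> 0" using mR m0 by (intro order_trans[OF norm_ge_zero M[of 0]]) simp
  obtain B where B: "B > 0" "\<And>(A :: real^'r^'m) q. norm (transpose A *v q) \<le> norm A * norm q * B"
    using bounded_bilinear.pos_bounded[OF bounded_bilinear_transpose_matrix_vector] by blast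
  define Q where "Q = (sqrt c\<^sub>1 + M) / sqrt \<theta>"
  have Q: "Q \<ge> 0" using c1 M0 \<theta>_pos by (simp add: Q_def)
  have "sqrt c\<^sub>2 \<le> sqrt c\<^sub>1 + d + e" if e: "e > 0" for e
  proof -
    define e' where "e' = e / (Q * B + 1)"
    have QB: "Q * B + 1 > 0" using Q B(1) by (simp add: add_nonneg_pos)
    have e': "e' > 0" "e' * (Q * B + 1) = e" using e QB by (simp_all add: e'_def)
    have "uniformly_continuous_on (cball 0 R) \<tau>" "uniformly_continuous_on (cball 0 R) s\<^sub>1"
      by (auto intro!: compact_uniformly_continuous
          continuous_on_subset[OF \<tau>_cont] continuous_on_subset[OF s])
    then obtain d1 d2 where d12: "d1 > 0" "d2 > 0"
      "\<And>x y. x \<in> cball 0 R \<Longrightarrow> y \<in> cball 0 R \<Longrightarrow> dist y x < d1 \<Longrightarrow> dist (\<tau> y) (\<tau> x) < e'"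
      "\<And>x y. x \<in> cball 0 R \<Longrightarrow> y \<in> cball 0 R \<Longrightarrow> dist y x < d2 \<Longrightarrow> dist (s\<^sub>1 y) (s\<^sub>1 x) < e'"
      unfolding uniformly_continuous_on_def using e'(1) by metis
    define k where "k = Q / min d1 d2 + 1"
    have k: "k \<ge> 1" using Q d12(1,2) by (simp add: k_def)
    have "Q < k * min d1 d2" using d12(1,2) by (simp add: k_def field_simps)
    obtain x y where xy: "x \<in> cball 0 R" "y \<in> cball 0 R"
      "Ham s\<^sub>1 y (k *\<^sub>R (x - y)) \<le> c\<^sub>1" "c\<^sub>2 \<le> Ham s\<^sub>2 x (k *\<^sub>R (x - y))"
      using pts[OF k] by blast
    define q where "q = k *\<^sub>R (x - y)"
    have "norm q \<le> (sqrt c\<^sub>1 + norm (s\<^sub>1 y)) / sqrt \<theta>"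
      using Ham_le_imp_gradient_bound[of s\<^sub>1 y q "sqrt c\<^sub>1"] xy(3) c1 by (simp add: q_def)
    also have "\<dots> \<le> Q"
      unfolding Q_def using M[OF xy(2)] \<theta>_pos by (intro divide_right_mono) auto
    finally have qQ: "norm q \<le> Q" .
    then have "k * norm (x - y) \<le> Q" using k by (simp add: q_def)
    then have "k * norm (x - y) < k * min d1 d2" using \<open>Q < k * min d1 d2\<close> by linarith
    then have "norm (x - y) < min d1 d2" using k by simp
    then have close: "norm (\<tau> x - \<tau> y) \<le> e'" "norm (s\<^sub>1 x - s\<^sub>1 y) \<le> e'"
      using d12(3)[OF xy(2,1)] d12(4)[OF xy(2,1)] by (simp_all add: dist_norm)
    have tri: "norm (a + b + c - d) \<le> norm a + norm b + norm c + norm d" for a b c d :: "real^'r"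
      using norm_triangle_ineq4[of "a + b + c" d] norm_triangle_ineq[of "a + b" c]
        norm_triangle_ineq[of a b] by linarith
    have "transpose (\<tau> x) *v q + s\<^sub>2 x = (transpose (\<tau> y) *v q + s\<^sub>1 y) +
      transpose (\<tau> x - \<tau> y) *v q + (s\<^sub>1 x - s\<^sub>1 y) - (s\<^sub>1 x - s\<^sub>2 x)"
      using bounded_bilinear.diff_left[OF bounded_bilinear_transpose_matrix_vector, of "\<tau> x" "\<tau> y" q]
      by (simp add: algebra_simps)
    then have "norm (transpose (\<tau> x) *v q + s\<^sub>2 x) \<le> norm (transpose (\<tau> y) *v q + s\<^sub>1 y) +
      norm (transpose (\<tau> x - \<tau> y) *v q) + norm (s\<^sub>1 x - s\<^sub>1 y) + norm (s\<^sub>1 x - s\<^sub>2 x)"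
      by (metis tri)
    moreover have "sqrt c\<^sub>2 \<le> norm (transpose (\<tau> x) *v q + s\<^sub>2 x)"
      using xy(4) unfolding Ham_def q_def[symmetric] by (rule real_le_lsqrt[OF norm_ge_zero])
    moreover have "norm (transpose (\<tau> y) *v q + s\<^sub>1 y) \<le> sqrt c\<^sub>1"
      using xy(3) unfolding Ham_def q_def[symmetric] by (rule real_le_rsqrt)
    moreover have "norm (transpose (\<tau> x - \<tau> y) *v q) \<le> e' * Q * B"
    proof -
      have "norm (transpose (\<tau> x - \<tau> y) *v q) \<le> norm (\<tau> x - \<tau> y) * norm q * B" by (rule B)
      also have "\<dots> \<le> e' * Q * B"
        using close qQ B(1) e'(1) by (intro mult_right_mono mult_mono) auto
      finally show ?thesis .
    qed
    moreover have "e' * Q * B + e' = e" using e'(2) by (simp add: algebra_simps)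
    ultimately show ?thesis using close(2) d[of x] by linarith
  qed
  then show ?thesis by (rule field_le_epsilon)
qed

text \<open>Perron's method for the discounted problem. Coercivity makes all competitors Lipschitz with one
  constant, so their infimum is continuous, and it inherits the supersolution property by
  stability; a bump argument gives the other inequality. The competitors need not be periodic: the
  infimum inherits periodicity from the invariance of the family under integer translations.\<close>

lemma discounted_corrector_exists:
  assumes s: "continuous_on UNIV s" "Z_periodic s" and C: "0 \<le> C" "\<And>y. norm (s y) \<le> C"
    and \<delta>: "0 < \<delta>"
  shows "\<exists>w. Z_periodic w \<and> (\<forall>y. 0 \<le> w y \<and> \<delta> * w y \<le> C\<^sup>2) \<and>
    (\<forall>x y. w x - w y \<le> 2 * C / sqrt \<theta> * norm (x - y)) \<and>
    viscosity_solution UNIV (\<lambda>y q. \<delta> * w y - Ham s y q) w"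
proof -
  define K where "K = 2 * C / sqrt \<theta>"
  have K0: "K \<ge> 0" using C \<theta>_pos by (simp add: K_def)
  define Fam where "Fam = {w. viscosity_supersolution UNIV (\<lambda>y q. \<delta> * w y - Ham s y q) w \<and>
    (\<forall>y. 0 \<le> w y \<and> \<delta> * w y \<le> C\<^sup>2)}"
  have FamD: "viscosity_supersolution UNIV (\<lambda>y q. \<delta> * w y - Ham s y q) w" "0 \<le> w y" "\<delta> * w y \<le> C\<^sup>2"
    if "w \<in> Fam" for w y
    using that by (auto simp: Fam_def)
  have Fam_lip: "w x - w y \<le> K * norm (x - y)" if w: "w \<in> Fam" for w x y
  proof (rule viscosity_supersolution_lipschitz[OF FamD(1)[OF w] FamD(2)[OF w] K0])
    fix z q :: "real^'m" assume "0 \<le> \<delta> * w z - Ham s z q"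
    then have "Ham s z q \<le> C\<^sup>2" using FamD(3)[OF w, of z] by simp
    then have "norm q \<le> (C + norm (s z)) / sqrt \<theta>" using C(1) by (rule Ham_le_imp_gradient_bound)
    also have "\<dots> \<le> K" unfolding K_def using C(2)[of z] \<theta>_pos by (intro divide_right_mono) auto
    finally show "norm q \<le> K" .
  qed
  have const: "(\<lambda>y. C\<^sup>2 / \<delta>) \<in> Fam"
    unfolding Fam_def viscosity_supersolution_def lsc_on_iff_usc_on_uminus
  proof (intro CollectI conjI allI impI ballI)
    fix \<phi> :: "real^'m \<Rightarrow> real" and D z assume D: "C1_test UNIV \<phi> D"
      "\<forall>\<^sub>F y in at z. C\<^sup>2 / \<delta> - \<phi> z \<le> C\<^sup>2 / \<delta> - \<phi> y"
    then have "D z = 0"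
      using C1_test_touching_gradient[OF C1_test_const D(1), of "C\<^sup>2 / \<delta>" z] by simp
    moreover have "(norm (s z))\<^sup>2 \<le> C\<^sup>2" using C by (intro power_mono) auto
    ultimately show "0 \<le> \<delta> * (C\<^sup>2 / \<delta>) - Ham s z (D z)"
      using \<delta> by (simp add: Ham_def)
  qed (use \<delta> in \<open>auto intro!: continuous_on_imp_usc_on\<close>)
  define W where "W y = (INF w\<in>Fam. w y)" for y
  have bdd: "bdd_below ((\<lambda>w. w y) ` Fam)" for y
    using FamD(2) by (intro bdd_belowI[of _ 0]) auto
  have W_le: "W y \<le> w y" if "w \<in> Fam" for w y
    unfolding W_def using bdd that by (rule cINF_lower)
  have W_ge: "c \<le> W y" if "\<And>w. w \<in> Fam \<Longrightarrow> c \<le> w y" for c y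
    unfolding W_def using const that by (intro cINF_greatest) auto
  have W_approx: "\<exists>w\<in>Fam. w y < W y + e" if "e > 0" for y e
    using cINF_less_iff[OF _ bdd, of y "W y + e"] const that unfolding W_def[symmetric] by force
  have W_bounds: "0 \<le> W y" "\<delta> * W y \<le> C\<^sup>2" for y
    using W_ge[of 0 y] FamD(2) W_le[OF const, of y] \<delta> by (auto simp: field_simps)
  have W_lip: "W x - W y \<le> K * norm (x - y)" for x y
  proof -
    have "W x - K * norm (x - y) \<le> w y" if "w \<in> Fam" for w
      using W_le[OF that, of x] Fam_lip[OF that, of x y] by simp
    then show ?thesis using W_ge[of "W x - K * norm (x - y)" y] by simp
  qed
  then have W_cont: "continuous_on UNIV W" by (rule lipschitz_bound_imp_continuous_on)
  have W_lsc: "lsc_on UNIV W" "usc_on UNIV W"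
    unfolding lsc_on_iff_usc_on_uminus
    by (intro continuous_on_imp_usc_on continuous_on_minus W_cont)+
  have W_per: "Z_periodic W"
  proof -
    have le: "W y \<le> W (y + k)" if k: "\<forall>i. k $ i \<in> \<int>" for y k
    proof (rule W_ge)
      fix w assume w: "w \<in> Fam"
      have "Ham s (y + k) q = Ham s y q" for y q
        using k s(2) \<tau>_per by (simp add: Ham_def Z_periodic_def)
      then have "(\<lambda>y. w (y + k)) \<in> Fam"
        using viscosity_supersolution_translate[OF FamD(1)[OF w], of k] FamD(2,3)[OF w]
        by (simp add: Fam_def)
      then show "W y \<le> w (y + k)" by (rule W_le)
    qed
    have "W (y + k) = W y" if k: "\<forall>i. k $ i \<in> \<int>" for y k
      using le[OF k, of y] le[of "- k" "y + k"] k by simp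
    then show ?thesis by (simp add: Z_periodic_def)
  qed
  have super: "viscosity_supersolution UNIV (\<lambda>y q. 0 + \<delta> * W y - Ham s y q) W"
  proof (rule viscosity_supersolution_stable[OF continuous_on_Ham[OF s(1)] W_lsc(1)])
    fix z and r e :: real assume "0 < e"
    then obtain w where w: "w \<in> Fam" "w z < W z + e" using W_approx by blast
    have "\<forall>y. W y - e \<le> w y"
      using W_le[OF w(1)] \<open>0 < e\<close> by (meson diff_le_eq less_imp_le order_trans le_add_same_cancel1)
    then show "\<exists>a' d' w'. viscosity_supersolution UNIV (\<lambda>y q. a' + d' * w' y - Ham s y q) w' \<and>
        \<bar>a' - 0\<bar> \<le> e \<and> \<bar>d' - \<delta>\<bar> \<le> e \<and> (\<forall>y\<in>cball z r. W y - e \<le> w' y) \<and> w' z \<le> W z + e"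
      using FamD(1)[OF w(1)] w(2) \<open>0 < e\<close>
      by (intro exI[of _ 0] exI[of _ \<delta>] exI[of _ w]) simp
  qed
  have sub: "viscosity_subsolution UNIV (\<lambda>y q. \<delta> * W y - Ham s y q) W"
    unfolding viscosity_subsolution_def
  proof (intro conjI allI impI ballI)
    fix \<phi> D z
    assume \<phi>: "C1_test UNIV \<phi> D" and ev: "\<forall>\<^sub>F y in at z. W y - \<phi> y \<le> W z - \<phi> z"
    show "\<delta> * W z - Ham s z (D z) \<le> 0"
    proof (rule ccontr)
      assume neg: "\<not> ?thesis"
      \<comment> \<open>If the inequality fails, then pushing \<^term>\<open>W\<close> below a bump at \<open>z\<close> gives a smaller
         competitor.\<close>
      define \<psi> where "\<psi> y = \<phi> y + (norm (y - z))\<^sup>2 + (W z - \<phi> z)" for y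
      define E where "E y = D y + 2 *\<^sub>R (y - z) + 0" for y
      have \<psi>: "C1_test UNIV \<psi> E"
        unfolding \<psi>_def E_def by (intro C1_test_add \<phi> C1_test_norm_power2 C1_test_const)
      have \<psi>_cont: "continuous_on UNIV \<psi>" by (rule C1_test_imp_continuous_on[OF \<psi>])
      define g where "g y = \<delta> * \<psi> y - Ham s y (E y)" for y
      have "continuous_on UNIV g"
        unfolding g_def using \<psi> by (intro continuous_intros \<psi>_cont continuous_on_Ham_compose s)
          (simp add: C1_test_def)
      then have "isCont g z" by (simp add: continuous_on_eq_continuous_at)
      have gz: "g z > 0" using neg by (simp add: g_def \<psi>_def E_def)
      obtain r1 where r1: "r1 > 0" "\<And>y. dist y z < r1 \<Longrightarrow> g z / 2 < g y"
      proof -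
        have "\<forall>\<^sub>F y in at z. g z / 2 < g y"
          using \<open>isCont g z\<close> gz by (intro order_tendstoD(1)[of g "g z"]) (auto simp: isCont_def)
        then obtain r where "r > 0" "\<And>y. y \<noteq> z \<Longrightarrow> dist y z < r \<Longrightarrow> g z / 2 < g y"
          unfolding eventually_at by auto
        then have "g z / 2 < g y" if "dist y z < r" for y
          using gz that by (cases "y = z") auto
        with \<open>r > 0\<close> show ?thesis by (rule that)
      qed
      obtain r2 where r2: "r2 > 0" "\<And>y. dist y z < r2 \<Longrightarrow> W y - \<phi> y \<le> W z - \<phi> z"
        using ev unfolding eventually_at by (metis UNIV_I order_refl)
      define r where "r = min r1 r2"
      have r: "r > 0" "\<And>y. y \<in> ball z r \<Longrightarrow> g z / 2 < g y"
        "\<And>y. y \<in> ball z r \<Longrightarrow> W y + (norm (y - z))\<^sup>2 \<le> \<psi> y"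
        using r1 r2 by (force simp: r_def dist_commute \<psi>_def)+
      \<comment> \<open>On the outer half of the ball \<^term>\<open>\<psi>\<close> exceeds \<^term>\<open>W\<close> by at least \<open>r\<^sup>2 / 4\<close>; the lowered bump is
         active in the inner half only, and the competitor stays continuous.\<close>
      define \<eta> where "\<eta> = min (r\<^sup>2 / 8) (g z / (2 * \<delta>))"
      have \<eta>: "\<eta> > 0" "\<eta> \<le> r\<^sup>2 / 8" "\<delta> * \<eta> \<le> g z / 2"
      proof -
        show "\<eta> > 0" "\<eta> \<le> r\<^sup>2 / 8" using r(1) gz \<delta> by (auto simp: \<eta>_def)
        have "\<delta> * \<eta> \<le> \<delta> * (g z / (2 * \<delta>))" using \<delta> by (intro mult_left_mono) (auto simp: \<eta>_def)
        then show "\<delta> * \<eta> \<le> g z / 2" using \<delta> by simp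
      qed
      define w where "w y = (if y \<in> ball z r then min (W y) (\<psi> y - \<eta>) else W y)" for y
      have w_le: "w y \<le> W y" for y by (simp add: w_def)
      have outer: "W y < \<psi> y - \<eta>" if "y \<in> ball z r" "y \<notin> cball z (r / 2)" for y
      proof -
        have "r / 2 \<le> norm (y - z)" using that by (simp add: dist_norm norm_minus_commute)
        then have "(r / 2)\<^sup>2 \<le> (norm (y - z))\<^sup>2" using r(1) by (intro power_mono) auto
        then have "r\<^sup>2 / 4 \<le> (norm (y - z))\<^sup>2" by (simp add: power_divide)
        moreover have "r\<^sup>2 > 0" using r(1) by simp
        ultimately show ?thesis using r(3)[OF that(1)] \<eta>(2) by linarith
      qed
      have bump: "Ham s y (E y) < \<delta> * (\<psi> y - \<eta>)" if "y \<in> ball z r" for y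
        using r(2)[OF that] \<eta>(3) unfolding g_def[of y] by (simp add: right_diff_distrib)
      have w_cont: "continuous_on UNIV w"
      proof -
        have "continuous_on (ball z r) (\<lambda>y. min (W y) (\<psi> y - \<eta>))"
          by (intro continuous_intros
              continuous_on_subset[OF W_cont] continuous_on_subset[OF \<psi>_cont]) auto
        then have 1: "continuous_on (ball z r) w"
          by (rule continuous_on_eq) (simp add: w_def)
        have "continuous_on (- cball z (r / 2)) W" using W_cont continuous_on_subset by blast
        then have 2: "continuous_on (- cball z (r / 2)) w"
          by (rule continuous_on_eq) (use outer in \<open>force simp: w_def\<close>)
        have "ball z r \<union> - cball z (r / 2) = UNIV" using r(1) by auto
        then show ?thesis
          using continuous_on_open_Un[OF open_ball _ 1 2] by (simp add: open_Compl)
      qed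
      have w0: "0 \<le> w y" for y
      proof (cases "y \<in> ball z r")
        case True
        have "0 \<le> Ham s y (E y)" by (simp add: Ham_def)
        then have "0 < \<delta> * (\<psi> y - \<eta>)" using bump[OF True] by linarith
        then show ?thesis using \<delta> W_bounds(1)[of y] by (simp add: w_def zero_less_mult_iff)
      qed (simp add: w_def W_bounds)
      have "viscosity_supersolution UNIV (\<lambda>y q. \<delta> * w y - Ham s y q) w"
        unfolding viscosity_supersolution_def lsc_on_iff_usc_on_uminus
      proof (intro conjI allI impI ballI continuous_on_imp_usc_on continuous_on_minus w_cont)
        fix \<phi>' D' y
        assume \<phi>': "C1_test UNIV \<phi>' D'" and ev': "\<forall>\<^sub>F x in at y. w y - \<phi>' y \<le> w x - \<phi>' x"
        show "0 \<le> \<delta> * w y - Ham s y (D' y)"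
        proof (cases "w y = W y")
          case True
          have "\<forall>\<^sub>F x in at y. W y - \<phi>' y \<le> W x - \<phi>' x"
            using ev'
          proof eventually_elim
            case (elim x)
            then show ?case using w_le[of x] True by simp
          qed
          then show ?thesis using super \<phi>' True unfolding viscosity_supersolution_def by auto
        next
          case False
          then have y: "y \<in> ball z r" "w y = \<psi> y - \<eta>" by (auto simp: w_def min_def split: if_splits)
          have "\<forall>\<^sub>F x in at y. x \<in> ball z r" using y(1) by (intro eventually_at_in_open') auto
          then have "\<forall>\<^sub>F x in at y. \<psi> y - \<phi>' y \<le> \<psi> x - \<phi>' x"
            using ev'
          proof eventually_elim
            case (elim x)
            then have "w x \<le> \<psi> x - \<eta>" by (simp add: w_def)
            then show ?case using elim y(2) by simp
          qed
          then have "E y = D' y" by (rule C1_test_touching_gradient[OF \<psi> \<phi>'])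
          then show ?thesis using bump[OF y(1)] y(2) by simp
        qed
      qed
      moreover have "\<delta> * w y \<le> C\<^sup>2" for y
        by (rule order_trans[OF mult_left_mono[OF w_le less_imp_le[OF \<delta>]] W_bounds(2)])
      ultimately have "w \<in> Fam" using w0 by (simp add: Fam_def)
      then have "W z \<le> w z" by (rule W_le)
      also have "\<dots> \<le> W z - \<eta>" using r(1) by (simp add: w_def \<psi>_def)
      finally show False using \<eta>(1) by simp
    qed
  qed (rule W_lsc)
  show ?thesis
    using W_per W_bounds W_lip super sub unfolding K_def
    by (intro exI[of _ W]) (simp add: viscosity_solution_def)
qed

text \<open>The vanishing discount limit. After subtraction of the value at the origin the discounted
  solutions are uniformly bounded and equi-Lipschitz, and the discounted value at the origin stays
  bounded; along a subsequence they converge to a corrector and to its constant.\<close>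

lemma corrector_exists:
  assumes s: "continuous_on UNIV s" "Z_periodic s"
  shows "\<exists>c w. Z_periodic w \<and> viscosity_solution UNIV (\<lambda>y q. c - Ham s y q) w"
proof -
  obtain C where C: "C \<ge> 0" "\<And>y. norm (s y) \<le> C"
    using Z_periodic_continuous_bounded[OF s(2,1)] by blast
  define K where "K = 2 * C / sqrt \<theta>"
  have K0: "K \<ge> 0" using C(1) \<theta>_pos by (simp add: K_def)
  define d where "d n = 1 / real (Suc n)" for n
  have d0: "d n > 0" for n by (simp add: d_def)
  have "\<forall>n. \<exists>w. Z_periodic w \<and> (\<forall>y. 0 \<le> w y \<and> d n * w y \<le> C\<^sup>2) \<and>
      (\<forall>x y. w x - w y \<le> K * norm (x - y)) \<and> viscosity_solution UNIV (\<lambda>y q. d n * w y - Ham s y q) w"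
    unfolding K_def using discounted_corrector_exists[OF s C d0] by blast
  from choice[OF this] obtain w where "\<forall>n. Z_periodic (w n) \<and>
      (\<forall>y. 0 \<le> w n y \<and> d n * w n y \<le> C\<^sup>2) \<and> (\<forall>x y. w n x - w n y \<le> K * norm (x - y)) \<and>
      viscosity_solution UNIV (\<lambda>y q. d n * w n y - Ham s y q) (w n)"
    by (rule exE)
  then have w: "\<And>n. Z_periodic (w n)" "\<And>n y. 0 \<le> w n y" "\<And>n y. d n * w n y \<le> C\<^sup>2"
    "\<And>n x y. w n x - w n y \<le> K * norm (x - y)"
    "\<And>n. viscosity_solution UNIV (\<lambda>y q. d n * w n y - Ham s y q) (w n)"
    by blast+
  have "\<forall>n. d n * w n 0 \<in> {0..C\<^sup>2}" using w(2,3) d0 by (simp add: less_imp_le)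
  then obtain c r where c: "strict_mono (r :: nat \<Rightarrow> nat)" "((\<lambda>n. d n * w n 0) \<circ> r) \<longlonglongrightarrow> c"
    by (rule seq_compactE[OF compact_imp_seq_compact[OF compact_Icc]])
  define f where "f n y = w (r n) y - w (r n) 0" for n y
  have f_lip: "f n x - f n y \<le> K * norm (x - y)" for n x y using w(4) by (simp add: f_def)
  have f_lip': "\<bar>f n x - f n y\<bar> \<le> K * norm (x - y)" for n x y
    using f_lip[of n x y] f_lip[of n y x] by (simp add: abs_le_iff norm_minus_commute)
  have f_per: "f n (y + k) = f n y" if "\<forall>i. k $ i \<in> \<int>" for n y k
    using w(1) that by (simp add: f_def Z_periodic_def)
  obtain m where m: "\<And>x :: real^'m. x \<in> cbox 0 1 \<Longrightarrow> norm x \<le> m"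
    using bounded_cbox[of 0 1] unfolding bounded_iff by blast
  obtain g \<kappa> where g: "strict_mono (\<kappa> :: nat \<Rightarrow> nat)"
    "\<And>e. 0 < e \<Longrightarrow> \<exists>N. \<forall>n x. N \<le> n \<and> x \<in> cbox 0 1 \<longrightarrow> norm (f (\<kappa> n) x - g x) < e"
  proof (rule Arzela_Ascoli[OF compact_cbox, of 0 1 f "K * m"])
    fix n and x :: "real^'m" assume "x \<in> cbox 0 1"
    then have "K * norm x \<le> K * m" using m K0 by (intro mult_left_mono) auto
    then show "norm (f n x) \<le> K * m" using f_lip'[of n x 0] by (simp add: f_def)
  next
    fix x :: "real^'m" and e :: real assume e: "0 < e"
    have pos: "K + 1 > 0" using K0 by simp
    have "norm (f n x - f n y) < e" if "norm (x - y) < e / (K + 1)" for n y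
    proof -
      have "norm (f n x - f n y) \<le> K * norm (x - y)" using f_lip' by simp
      also have "\<dots> \<le> (K + 1) * norm (x - y)" by (intro mult_right_mono) auto
      also have "\<dots> < e" using that pos by (simp add: field_simps)
      finally show ?thesis .
    qed
    then show "\<exists>d>0. \<forall>n y. y \<in> cbox 0 1 \<and> norm (x - y) < d \<longrightarrow> norm (f n x - f n y) < e"
      using e pos by (intro exI[of _ "e / (K + 1)"]) auto
  qed blast
  \<comment> \<open>The limit on the cube is extended to a periodic function.\<close>
  obtain j :: "real^'m \<Rightarrow> real^'m" where j: "\<And>y i. j y $ i \<in> \<int>" "\<And>y. y + j y \<in> cbox 0 1"
    using cube_representative by metis
  define u where "u y = g (y + j y)" for y
  define h where "h n = f (\<kappa> n)" for n
  have unif: "\<exists>N. \<forall>n\<ge>N. \<forall>y. \<bar>h n y - u y\<bar> < e" if "e > 0" for e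
    using g(2)[OF that] f_per[OF allI[OF j(1)]] j(2) unfolding u_def h_def by (metis real_norm_def)
  then have lim: "(\<lambda>n. h n y) \<longlonglongrightarrow> u y" for y
    unfolding LIMSEQ_iff real_norm_def by meson
  have "u x - u y \<le> K * norm (x - y)" for x y
    by (rule LIMSEQ_le_const2[OF tendsto_diff[OF lim lim]]) (use f_lip in \<open>auto simp: h_def\<close>)
  then have "continuous_on UNIV u" by (rule lipschitz_bound_imp_continuous_on)
  then have lsc: "lsc_on UNIV u" "lsc_on UNIV (\<lambda>y. - u y)"
    unfolding lsc_on_iff_usc_on_uminus by (auto intro!: continuous_on_imp_usc_on continuous_intros)
  have "Z_periodic u"
    unfolding Z_periodic_def
  proof (intro allI impI)
    fix y k :: "real^'m" assume k: "\<forall>i. k $ i \<in> \<int>"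
    have "(\<lambda>n. h n y) \<longlonglongrightarrow> u (y + k)" using lim[of "y + k"] f_per[OF k] by (simp add: h_def)
    then show "u (y + k) = u y" using lim LIMSEQ_unique by blast
  qed
  define a where "a n = d (r (\<kappa> n)) * w (r (\<kappa> n)) 0" for n
  define b where "b n = d (r (\<kappa> n))" for n
  have sub_n: "viscosity_subsolution UNIV (\<lambda>y q. a n + b n * h n y - Ham s y q) (h n)"
    and super_n: "viscosity_supersolution UNIV (\<lambda>y q. a n + b n * h n y - Ham s y q) (h n)" for n
  proof -
    let ?w = "w (r (\<kappa> n))"
    have eq: "(\<lambda>y q. b n * ?w y - Ham s y q) = (\<lambda>y q. a n + b n * h n y - Ham s y q)"
      by (simp add: fun_eq_iff a_def b_def h_def f_def algebra_simps)
    have h: "h n = (\<lambda>y. ?w y + - ?w 0)" "(\<lambda>y. - h n y) = (\<lambda>y. - ?w y + ?w 0)"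
      by (simp_all add: fun_eq_iff h_def f_def)
    have ws: "viscosity_solution UNIV (\<lambda>y q. b n * ?w y - Ham s y q) ?w"
      unfolding b_def by (rule w(5))
    show "viscosity_supersolution UNIV (\<lambda>y q. a n + b n * h n y - Ham s y q) (h n)"
      using ws viscosity_supersolution_add_const[of UNIV _ ?w "- ?w 0"]
      unfolding viscosity_solution_def eq h(1)[symmetric] by blast
    show "viscosity_subsolution UNIV (\<lambda>y q. a n + b n * h n y - Ham s y q) (h n)"
      using ws viscosity_supersolution_add_const[of UNIV _ "\<lambda>y. - ?w y" "?w 0"]
      unfolding viscosity_solution_def viscosity_subsolution_iff_supersolution eq h(2)[symmetric]
      by blast
  qed
  have a_lim: "a \<longlonglongrightarrow> c"
    using LIMSEQ_subseq_LIMSEQ[OF c(2) g(1)] by (simp add: a_def[abs_def] comp_def)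
  have d_lim: "d \<longlonglongrightarrow> 0"
    unfolding d_def using LIMSEQ_inverse_real_of_nat by (simp add: inverse_eq_divide)
  have b_lim: "b \<longlonglongrightarrow> 0"
    using LIMSEQ_subseq_LIMSEQ[OF LIMSEQ_subseq_LIMSEQ[OF d_lim c(1)] g(1)]
    by (simp add: b_def[abs_def] comp_def)
  have approx: "\<exists>n. \<bar>a n - c\<bar> \<le> e \<and> \<bar>b n - 0\<bar> \<le> e \<and> (\<forall>y. \<bar>h n y - u y\<bar> \<le> e)" if e: "e > 0" for e
  proof -
    obtain N1 where "\<forall>n\<ge>N1. \<forall>y. \<bar>h n y - u y\<bar> < e" using unif[OF e] by blast
    moreover obtain N2 where "\<forall>n\<ge>N2. \<bar>a n - c\<bar> < e" using LIMSEQ_D[OF a_lim e] by auto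
    moreover obtain N3 where "\<forall>n\<ge>N3. \<bar>b n - 0\<bar> < e" using LIMSEQ_D[OF b_lim e] by auto
    ultimately show ?thesis
      by (intro exI[of _ "max N1 (max N2 N3)"]) (auto intro: less_imp_le)
  qed
  have "viscosity_supersolution UNIV (\<lambda>y q. c + 0 * u y - Ham s y q) u"
  proof (rule viscosity_supersolution_stable[OF continuous_on_Ham[OF s(1)] lsc(1)])
    fix z and \<rho> e :: real assume "0 < e"
    then obtain n where n: "\<bar>a n - c\<bar> \<le> e" "\<bar>b n - 0\<bar> \<le> e" "\<And>y. \<bar>h n y - u y\<bar> \<le> e"
      using approx by blast
    have "u y - e \<le> h n y \<and> h n y \<le> u y + e" for y using n(3)[of y] by (simp add: abs_le_iff)
    then show "\<exists>a' d' w'. viscosity_supersolution UNIV (\<lambda>y q. a' + d' * w' y - Ham s y q) w' \<and>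
        \<bar>a' - c\<bar> \<le> e \<and> \<bar>d' - 0\<bar> \<le> e \<and> (\<forall>y\<in>cball z \<rho>. u y - e \<le> w' y) \<and> w' z \<le> u z + e"
      using super_n[of n] n(1,2) by blast
  qed
  moreover have "viscosity_supersolution UNIV (\<lambda>y q. - c + 0 * (- u y) - (- Ham s y (- q))) (\<lambda>y. - u y)"
  proof (rule viscosity_supersolution_stable[OF _ lsc(2)])
    have "continuous_on UNIV (\<lambda>z. (fst z, - snd z) :: (real^'m) \<times> (real^'m))"
      by (intro continuous_intros)
    from continuous_on_minus[OF continuous_on_compose2[OF continuous_on_Ham[OF s(1)] this]]
    show "continuous_on UNIV (\<lambda>(y, q). - Ham s y (- q))" by (simp add: case_prod_unfold)
    fix z and \<rho> e :: real assume "0 < e"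
    then obtain n where n: "\<bar>a n - c\<bar> \<le> e" "\<bar>b n - 0\<bar> \<le> e" "\<And>y. \<bar>h n y - u y\<bar> \<le> e"
      using approx by blast
    have le: "- u y - e \<le> - h n y \<and> - h n y \<le> - u y + e" for y using n(3)[of y] by (simp add: abs_le_iff)
    have "viscosity_supersolution UNIV (\<lambda>y q. - a n + b n * (- h n y) - (- Ham s y (- q))) (\<lambda>y. - h n y)"
      using sub_n[of n] unfolding viscosity_subsolution_iff_supersolution by (simp add: algebra_simps)
    moreover have "\<bar>- a n - (- c)\<bar> \<le> e" using n(1) by (simp add: abs_minus_commute)
    ultimately show "\<exists>a' d' w'. viscosity_supersolution UNIV (\<lambda>y q. a' + d' * w' y - (- Ham s y (- q))) w' \<and>
        \<bar>a' - (- c)\<bar> \<le> e \<and> \<bar>d' - 0\<bar> \<le> e \<and> (\<forall>y\<in>cball z \<rho>. - u y - e \<le> w' y) \<and> w' z \<le> - u z + e"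
      using le n(2) by (intro exI[of _ "- a n"] exI[of _ "b n"] exI[of _ "\<lambda>y. - h n y"]) blast
  qed
  ultimately have "viscosity_solution UNIV (\<lambda>y q. c - Ham s y q) u"
    unfolding viscosity_solution_def viscosity_subsolution_iff_supersolution by (simp add: algebra_simps)
  then show ?thesis using \<open>Z_periodic u\<close> by blast
qed

text \<open>At a minimum of \<open>w\<close> the zero gradient is admissible.\<close>

lemma corrector_constant_nonneg:
  assumes "Z_periodic w" "viscosity_supersolution UNIV (\<lambda>y q. c - Ham s y q) w"
  shows "0 \<le> c"
proof -
  have "usc_on UNIV (\<lambda>y. - w y)"
    using assms(2) by (simp add: viscosity_supersolution_def lsc_on_iff_usc_on_uminus)
  then obtain z where "\<And>y. - w y \<le> - w z"
    using Z_periodic_attains_max[of "\<lambda>y. - w y"] assms(1) unfolding Z_periodic_def by auto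
  then have "0 \<le> c - Ham s z 0"
    by (intro viscosity_supersolutionD[OF assms(2) C1_test_const[of _ 0]]) auto
  moreover have "0 \<le> Ham s z 0" by (simp add: Ham_def)
  ultimately show ?thesis by linarith
qed

end

section \<open>The effective Hamiltonian\<close>

locale effective_cell = coercive_cell \<tau> \<theta>
  for \<tau> :: "real^'m \<Rightarrow> real^'r^'m" and \<theta> :: real +
  fixes \<sigma> :: "real^'n \<Rightarrow> real^'m \<Rightarrow> real^'r^'n"
  assumes \<sigma>_cont: "continuous_on UNIV (\<sigma> x)" and \<sigma>_per: "Z_periodic (\<sigma> x)"
begin

definition forcing :: "real^'n \<Rightarrow> real^'n \<Rightarrow> real^'m \<Rightarrow> real^'r" where
  "forcing x p y = transpose (\<sigma> x y) *v p"

abbreviation Heff :: "real^'n \<Rightarrow> real^'n \<Rightarrow> real" where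
  "Heff \<equiv> effective_hamiltonian \<sigma> \<tau>"

lemma cell_operator_eq_Ham: "cell_operator \<sigma> \<tau> x p c = (\<lambda>y q. c - Ham (forcing x p) y q)"
  by (simp add: fun_eq_iff cell_operator_def Ham_def forcing_def)

lemma continuous_on_forcing: "continuous_on UNIV (forcing x p)"
  unfolding forcing_def
  by (intro bounded_bilinear.continuous_on[OF bounded_bilinear_transpose_matrix_vector]
      \<sigma>_cont continuous_on_const)

lemma Z_periodic_forcing: "Z_periodic (forcing x p)"
  using \<sigma>_per by (simp add: Z_periodic_def forcing_def)

lemma corrector_constant_unique:
  assumes "Z_periodic w" "viscosity_solution UNIV (\<lambda>y q. c - Ham (forcing x p) y q) w"
    and "Z_periodic w'" "viscosity_solution UNIV (\<lambda>y q. c' - Ham (forcing x p) y q) w'"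
  shows "c = c'"
proof -
  note sol = assms(2,4)[unfolded viscosity_solution_def]
  have "sqrt c \<le> sqrt c' + 0"
    by (rule corrector_comparison[OF continuous_on_forcing assms(3) conjunct2[OF sol(2)]
          assms(1) conjunct1[OF sol(1)]]) simp
  moreover have "sqrt c' \<le> sqrt c + 0"
    by (rule corrector_comparison[OF continuous_on_forcing assms(1) conjunct2[OF sol(1)]
          assms(3) conjunct1[OF sol(2)]]) simp
  ultimately show ?thesis by simp
qed

lemma Heff_corrector:
  "\<exists>w. Z_periodic w \<and> viscosity_solution UNIV (\<lambda>y q. Heff x p - Ham (forcing x p) y q) w"
proof -
  have "\<exists>!c. \<exists>w. Z_periodic w \<and> viscosity_solution UNIV (\<lambda>y q. c - Ham (forcing x p) y q) w"
    using corrector_exists[OF continuous_on_forcing Z_periodic_forcing]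
      corrector_constant_unique by blast
  from theI'[OF this] show ?thesis
    unfolding effective_hamiltonian_def cell_operator_eq_Ham .
qed

lemma Heff_eqI:
  assumes "Z_periodic w" "viscosity_solution UNIV (\<lambda>y q. c - Ham (forcing x p) y q) w"
  shows "Heff x p = c"
  using Heff_corrector corrector_constant_unique assms by blast

lemma Heff_nonneg: "0 \<le> Heff x p"
  using Heff_corrector corrector_constant_nonneg unfolding viscosity_solution_def by blast

text \<open>A corrector for \<open>p\<close>, multiplied by \<open>k\<close>, is a corrector for \<open>k p\<close>.\<close>

lemma Heff_scale:
  assumes k: "k > 0"
  shows "Heff x (k *\<^sub>R p) = k\<^sup>2 * Heff x p"
proof -
  obtain w where w: "Z_periodic w" "viscosity_solution UNIV (\<lambda>y q. Heff x p - Ham (forcing x p) y q) w"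
    using Heff_corrector by blast
  have Ham: "Ham (forcing x (k *\<^sub>R p)) y q = k\<^sup>2 * Ham (forcing x p) y ((1 / k) *\<^sub>R q)" for y q
  proof -
    have "transpose (\<tau> y) *v q + forcing x (k *\<^sub>R p) y =
      k *\<^sub>R (transpose (\<tau> y) *v ((1 / k) *\<^sub>R q) + forcing x p y)"
      using k by (simp add: forcing_def scaleR_right_distrib
          bounded_bilinear.scaleR_right[OF bounded_bilinear_transpose_matrix_vector]
          del: transpose_matrix_vector)
    then show ?thesis using k by (simp only: Ham_def norm_scaleR power_mult_distrib power2_abs)
  qed
  have eq: "k\<^sup>2 * Heff x p - Ham (forcing x (k *\<^sub>R p)) y q =
    k\<^sup>2 * (Heff x p - Ham (forcing x p) y ((1 / k) *\<^sub>R q))" for y q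
    by (simp add: Ham right_diff_distrib)
  have "viscosity_solution UNIV (\<lambda>y q. k\<^sup>2 * Heff x p - Ham (forcing x (k *\<^sub>R p)) y q) (\<lambda>y. k * w y)"
    unfolding viscosity_solution_def
  proof
    show "viscosity_subsolution UNIV (\<lambda>y q. k\<^sup>2 * Heff x p - Ham (forcing x (k *\<^sub>R p)) y q) (\<lambda>y. k * w y)"
      using w(2) k unfolding eq viscosity_solution_def
      by (blast intro: viscosity_subsolution_mono[OF viscosity_subsolution_scale] mult_nonneg_nonpos
          zero_le_power2)
    show "viscosity_supersolution UNIV (\<lambda>y q. k\<^sup>2 * Heff x p - Ham (forcing x (k *\<^sub>R p)) y q) (\<lambda>y. k * w y)"
      using w(2) k unfolding eq viscosity_solution_def
      by (blast intro: viscosity_supersolution_mono[OF viscosity_supersolution_scale] mult_nonneg_nonneg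
          zero_le_power2)
  qed
  moreover have "Z_periodic (\<lambda>y. k * w y)" using w(1) by (simp add: Z_periodic_def)
  ultimately show ?thesis by (intro Heff_eqI)
qed

text \<open>The form in which regularity of the effective Hamiltonian is used. Its square root is 1-Lipschitz
  with respect to the uniform distance of the data \<open>\<sigma>\<^sup>T p\<close>; the effective Hamiltonian itself has no
  such modulus, since it grows quadratically.\<close>

lemma sqrt_Heff_le:
  assumes "\<And>y. norm (forcing x' p' y - forcing x p y) \<le> d"
  shows "sqrt (Heff x p) \<le> sqrt (Heff x' p') + d"
  using Heff_corrector[of x p] Heff_corrector[of x' p'] assms
    corrector_comparison[OF continuous_on_forcing]
  unfolding viscosity_solution_def by blast

end

section \<open>Logarithmic penalisation\<close>

text \<open>For \<open>K > 0\<close> the function \<open>ln (1 + K \<bar>w\<bar>\<^sup>2)\<close> is unbounded, while \<open>\<bar>w\<bar>\<close> times the length of its gradient never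
  exceeds 2, whatever \<open>K\<close> is. As a penalty in a doubling argument it therefore makes
  \<open>\<bar>x - y\<bar> \<bar>q\<bar>\<close> small beforehand, where a quadratic penalty would give this only in the limit; and with
  \<open>K = 1\<close> it confines maximum points at the cost of a small gradient.\<close>

definition log_penalty :: "real \<Rightarrow> 'a::euclidean_space \<Rightarrow> real" where
  "log_penalty K w = ln (1 + K * (norm w)\<^sup>2)"

definition log_penalty_grad :: "real \<Rightarrow> 'a::euclidean_space \<Rightarrow> 'a" where
  "log_penalty_grad K w = (2 * K / (1 + K * (norm w)\<^sup>2)) *\<^sub>R w"

lemma log_penalty_pos_arg: "0 \<le> K \<Longrightarrow> 0 < 1 + K * (norm w)\<^sup>2"
  by (simp add: add_pos_nonneg)

lemma log_penalty_nonneg: "0 \<le> K \<Longrightarrow> 0 \<le> log_penalty K w"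
  by (simp add: log_penalty_def)

lemma log_penalty_minus_commute: "log_penalty K (a - b) = log_penalty K (b - a)"
  by (simp add: log_penalty_def norm_minus_commute)

lemma log_penalty_grad_minus: "log_penalty_grad K (a - b) = - log_penalty_grad K (b - a)"
  unfolding log_penalty_grad_def norm_minus_commute[of a b] by (metis minus_diff_eq scaleR_minus_right)

lemma C1_test_log_penalty:
  assumes "0 \<le> K"
  shows "C1_test \<Omega> (\<lambda>y. log_penalty K (y - a)) (\<lambda>y. log_penalty_grad K (y - a))"
  unfolding C1_test_def
proof (intro conjI ballI)
  fix z
  have "GDERIV (\<lambda>y. 1 + K * (norm (y - a))\<^sup>2) z :> 0 + K *\<^sub>R (2 *\<^sub>R (z - a))"
    by (intro GDERIV_add GDERIV_const GDERIV_cmult GDERIV_norm_power2)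
  moreover have "DERIV ln (1 + K * (norm (z - a))\<^sup>2) :> inverse (1 + K * (norm (z - a))\<^sup>2)"
    by (rule DERIV_ln[OF log_penalty_pos_arg[OF assms]])
  ultimately have "GDERIV (\<lambda>y. ln (1 + K * (norm (y - a))\<^sup>2)) z :>
      inverse (1 + K * (norm (z - a))\<^sup>2) *\<^sub>R (0 + K *\<^sub>R (2 *\<^sub>R (z - a)))"
    by (rule GDERIV_DERIV_compose)
  then show "GDERIV (\<lambda>y. log_penalty K (y - a)) z :> log_penalty_grad K (z - a)"
    by (simp add: log_penalty_def log_penalty_grad_def divide_inverse mult.commute mult.assoc)
next
  show "continuous_on \<Omega> (\<lambda>y. log_penalty_grad K (y - a))"
    unfolding log_penalty_grad_def
    by (intro continuous_intros ballI)
      (rule less_imp_neq[OF log_penalty_pos_arg[OF assms], symmetric])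
qed

lemma norm_mult_log_penalty_grad_le:
  assumes "0 \<le> K"
  shows "norm w * norm (log_penalty_grad K w) \<le> 2"
proof -
  have pos: "0 < 1 + K * (norm w)\<^sup>2" by (rule log_penalty_pos_arg[OF assms])
  have "norm w * norm (log_penalty_grad K w) = 2 * (K * (norm w)\<^sup>2) / (1 + K * (norm w)\<^sup>2)"
    using pos assms by (simp add: log_penalty_grad_def power2_eq_square abs_mult)
  also have "\<dots> \<le> 2" using pos by (simp add: field_simps)
  finally show ?thesis .
qed

lemma norm_log_penalty_grad_1_le: "norm (log_penalty_grad 1 w) \<le> 1"
proof -
  have pos: "0 < 1 + (norm w)\<^sup>2" using log_penalty_pos_arg[of 1 w] by simp
  have "2 * norm w \<le> 1 + (norm w)\<^sup>2"
    using zero_le_power2[of "norm w - 1"] by (simp add: power2_diff)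
  then show ?thesis using pos by (simp add: log_penalty_grad_def field_simps)
qed

lemma log_penalty_less_imp:
  assumes "log_penalty K w < c"
    "0 \<le> K"
  shows "K * (norm w)\<^sup>2 < exp c"
proof -
  have "exp (log_penalty K w) < exp c" using assms(1) by simp
  then show ?thesis
    unfolding log_penalty_def exp_ln[OF log_penalty_pos_arg[OF assms(2)]] by linarith
qed

lemma norm_snd_le_norm: "norm (snd w) \<le> norm w"
  using norm_snd_le[of "snd w" "fst w"] by simp

lemma C1_test_snd:
  fixes f :: "'b::euclidean_space \<Rightarrow> real" and \<Omega> :: "('a::euclidean_space \<times> 'b) set"
  assumes "C1_test UNIV f D"
  shows "C1_test \<Omega> (\<lambda>z. f (snd z)) (\<lambda>z. (0, D (snd z)))"
  unfolding C1_test_def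
proof (intro conjI ballI)
  fix z :: "'a \<times> 'b"
  have "(f has_derivative (\<lambda>h. h \<bullet> D (snd z))) (at (snd z))"
    using assms by (simp add: C1_test_def gderiv_def)
  moreover have "(snd has_derivative snd) (at z)" by (auto intro!: derivative_eq_intros)
  ultimately show "GDERIV (\<lambda>z. f (snd z)) z :> (0, D (snd z))"
    unfolding gderiv_def
    using has_derivative_compose[of snd snd z UNIV f "\<lambda>h. h \<bullet> D (snd z)"]
    by (simp add: inner_prod_def)
next
  have "continuous_on UNIV D" using assms by (simp add: C1_test_def)
  then have "continuous_on \<Omega> (\<lambda>z. D (snd z))"
    by (rule continuous_on_compose2[OF _ continuous_on_snd[OF continuous_on_id]]) simp
  then show "continuous_on \<Omega> (\<lambda>z. (0 :: 'a, D (snd z)))"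
    by (rule continuous_on_Pair[OF continuous_on_const])
qed

lemma C1_test_fst:
  fixes \<Omega> :: "(real \<times> 'b::euclidean_space) set"
  assumes "\<And>t. t \<in> I \<Longrightarrow> DERIV f t :> d t" "continuous_on I d" "fst ` \<Omega> \<subseteq> I"
  shows "C1_test \<Omega> (\<lambda>z. f (fst z)) (\<lambda>z. (d (fst z), 0))"
  unfolding C1_test_def
proof (intro conjI ballI)
  fix z assume "z \<in> \<Omega>"
  then have "(f has_derivative (\<lambda>h. h * d (fst z))) (at (fst z))"
    using assms(1,3) by (auto simp: has_field_derivative_def mult_commute_abs)
  moreover have "(fst has_derivative fst) (at z)" by (auto intro!: derivative_eq_intros)
  ultimately show "GDERIV (\<lambda>z. f (fst z)) z :> (d (fst z), 0)"
    unfolding gderiv_def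
    using has_derivative_compose[of fst fst z UNIV f "\<lambda>h. h * d (fst z)"]
    by (simp add: inner_prod_def)
next
  have "continuous_on \<Omega> (\<lambda>z. d (fst z))"
    by (rule continuous_on_compose2[OF assms(2) continuous_on_fst[OF continuous_on_id] assms(3)])
  then show "continuous_on \<Omega> (\<lambda>z. (d (fst z), 0 :: 'b))"
    by (rule continuous_on_Pair[OF _ continuous_on_const])
qed

section \<open>Comparison for the evolution equation\<close>

lemma upper_terminal_value_approached:
  assumes "upper_terminal_value T u x" "e > 0" "d > 0"
  shows "\<exists>z\<in>{0<..<T} \<times> UNIV. dist z (T, x) < d \<and> u (T, x) - e < u z"
proof (rule ccontr)
  assume neg: "\<not> ?thesis"
  have le: "u z \<le> u (T, x) - e" if "z \<in> {0<..<T} \<times> UNIV" "dist z (T, x) < d" for z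
    using neg that by (meson not_less)
  have "\<forall>\<^sub>F z in at (T, x) within {0<..<T} \<times> UNIV. ereal (u z) \<le> ereal (u (T, x) - e)"
    unfolding eventually_at using le assms(3) by (intro exI[of _ d]) simp
  then have "Limsup (at (T, x) within {0<..<T} \<times> UNIV) (\<lambda>z. ereal (u z)) \<le> ereal (u (T, x) - e)"
    by (rule Limsup_bounded)
  then have "ereal (u (T, x)) \<le> ereal (u (T, x) - e)"
    using assms(1) unfolding upper_terminal_value_def by (rule order_trans[rotated])
  then show False using assms(2) by simp
qed

lemma lower_terminal_value_approached:
  assumes "lower_terminal_value T v x" "e > 0" "d > 0"
  shows "\<exists>z\<in>{0<..<T} \<times> UNIV. dist z (T, x) < d \<and> v z < v (T, x) + e"
proof (rule ccontr)
  assume neg: "\<not> ?thesis"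
  have le: "v (T, x) + e \<le> v z" if "z \<in> {0<..<T} \<times> UNIV" "dist z (T, x) < d" for z
    using neg that by (meson not_less)
  have "\<forall>\<^sub>F z in at (T, x) within {0<..<T} \<times> UNIV. ereal (v (T, x) + e) \<le> ereal (v z)"
    unfolding eventually_at using le assms(3) by (intro exI[of _ d]) simp
  then have "ereal (v (T, x) + e) \<le> Liminf (at (T, x) within {0<..<T} \<times> UNIV) (\<lambda>z. ereal (v z))"
    by (rule Liminf_bounded)
  then have "ereal (v (T, x) + e) \<le> ereal (v (T, x))"
    using assms(1) unfolding lower_terminal_value_def by (rule order_trans)
  then show False using assms(2) by simp
qed

text \<open>Convexity of the square: \<open>g + \<delta>\<close> is the mean of \<open>g / k\<close> and \<open>\<delta> / (1 - k)\<close> with weights \<open>k\<close> and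
  \<open>1 - k\<close>.\<close>

lemma power2_add_le_weighted:
  fixes g k \<delta> :: real
  assumes "0 < k" "k < 1"
  shows "(g + \<delta>)\<^sup>2 \<le> g\<^sup>2 / k + \<delta>\<^sup>2 / (1 - k)"
proof -
  have "0 \<le> ((1 - k) * g - k * \<delta>)\<^sup>2" by simp
  then have "0 \<le> ((1 - k) * g - k * \<delta>)\<^sup>2 / (k * (1 - k))" using assms by simp
  also have "\<dots> = g\<^sup>2 / k + \<delta>\<^sup>2 / (1 - k) - (g + \<delta>)\<^sup>2"
    using assms by (simp add: field_simps power2_eq_square)
  finally show ?thesis by simp
qed

text \<open>The functional of the doubling argument. Only \<open>v\<close> carries the factor \<open>k < 1\<close>. The terms with
  \<open>\<kappa>\<close> keep maximum points away from the final time.\<close>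

definition doubled ::
  "real \<Rightarrow> real \<Rightarrow> real \<Rightarrow> real \<Rightarrow> real \<Rightarrow> real \<Rightarrow> real \<Rightarrow> (real \<times> 'a::euclidean_space \<Rightarrow> real) \<Rightarrow>
    (real \<times> 'a \<Rightarrow> real) \<Rightarrow> real \<times> 'a \<Rightarrow> real \<times> 'a \<Rightarrow> real" where
  "doubled T k \<mu> K \<beta> \<eta> \<kappa> u v z z' =
     u z - k * v z' - \<mu> * log_penalty K (z - z') - \<beta> * log_penalty 1 (snd z) - \<eta> * fst z
       - \<kappa> / (T - fst z) - \<kappa> / (T - fst z')"

text \<open>At a maximum of the doubled functional the two viscosity inequalities give
  \<open>\<eta> + G(y, q)\<^sup>2 / k \<le> G(x, p)\<^sup>2\<close> with \<open>G(x, p) \<le> G(y, q) + \<delta>\<close>. The factor \<open>1 / k > 1\<close>, which comes from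
  homogeneity, absorbs the mixed term \<open>2 \<delta> G(y, q)\<close>; it is not controlled otherwise, since no
  gradient bound is available. For the logarithmic penalisation \<open>\<bar>x - y\<bar> \<bar>q\<bar> \<le> 2 \<mu>\<close> holds at all
  points, so \<open>\<delta>\<close> is small with \<open>\<mu>\<close> and \<open>\<beta>\<close>.\<close>

lemma doubled_max_imp:
  fixes G :: "'a::euclidean_space \<Rightarrow> 'a \<Rightarrow> real" and u v :: "real \<times> 'a \<Rightarrow> real"
    and T :: real
  defines "\<Omega> \<equiv> {0<..<T} \<times> UNIV"
  assumes G0: "\<And>x p. 0 \<le> G x p"
    and G_scale: "\<And>x p k. 0 < k \<Longrightarrow> G x (k *\<^sub>R p) = k * G x p"
    and G_x: "\<And>x y p. G x p \<le> G y p + L * (norm (x - y) * norm p)"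
    and G_p: "\<And>x p q. G x p \<le> G x q + M * norm (p - q)" and LM: "0 \<le> L" "0 \<le> M"
    and sub: "viscosity_subsolution \<Omega> (evolution_operator (\<lambda>x p. (G x p)\<^sup>2)) u"
    and super: "viscosity_supersolution \<Omega> (evolution_operator (\<lambda>x p. (G x p)\<^sup>2)) v"
    and k: "0 < k" "k < 1" and par: "0 \<le> \<mu>" "0 \<le> K" "0 \<le> \<beta>" "0 \<le> \<kappa>"
    and z: "z \<in> \<Omega>" "z' \<in> \<Omega>"
    and max1: "\<And>y. y \<in> \<Omega> \<Longrightarrow> doubled T k \<mu> K \<beta> \<eta> \<kappa> u v y z' \<le> doubled T k \<mu> K \<beta> \<eta> \<kappa> u v z z'"
    and max2: "\<And>y. y \<in> \<Omega> \<Longrightarrow> doubled T k \<mu> K \<beta> \<eta> \<kappa> u v z y \<le> doubled T k \<mu> K \<beta> \<eta> \<kappa> u v z z'"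
  shows "\<eta> \<le> (2 * L * \<mu> + M * \<beta>)\<^sup>2 / (1 - k)"
proof -
  define P where "P = \<mu> *\<^sub>R log_penalty_grad K (z - z')"
  have fst\<Omega>: "fst ` \<Omega> \<subseteq> {0<..<T}" by (auto simp: \<Omega>_def)
  have time: "C1_test \<Omega> (\<lambda>y. a * fst y + b / (T - fst y)) (\<lambda>y. (a + b / (T - fst y)\<^sup>2, 0 :: 'a))" for a b
  proof (rule C1_test_fst[OF _ _ fst\<Omega>])
    show "DERIV (\<lambda>s. a * s + b / (T - s)) s :> a + b / (T - s)\<^sup>2" if "s \<in> {0<..<T}" for s
      using that by (auto intro!: derivative_eq_intros simp: power2_eq_square)
    show "continuous_on {0<..<T} (\<lambda>s. a + b / (T - s)\<^sup>2)"
      by (intro continuous_intros) auto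
  qed
  have C1: "C1_test \<Omega>
      (\<lambda>y. \<mu> * log_penalty K (y - z') + \<beta> * log_penalty 1 (snd y - 0) + (\<eta> * fst y + \<kappa> / (T - fst y)))
      (\<lambda>y. \<mu> *\<^sub>R log_penalty_grad K (y - z') + \<beta> *\<^sub>R (0, log_penalty_grad 1 (snd y - 0)) +
        (\<eta> + \<kappa> / (T - fst y)\<^sup>2, 0))"
    by (intro C1_test_add C1_test_cmult
        C1_test_snd[OF C1_test_log_penalty] C1_test_log_penalty time par(2)) simp
  have C2: "C1_test \<Omega> (\<lambda>y. (- \<mu> / k) * log_penalty K (y - z) + (0 * fst y + (- \<kappa> / k) / (T - fst y)))
      (\<lambda>y. (- \<mu> / k) *\<^sub>R log_penalty_grad K (y - z) + (0 + (- \<kappa> / k) / (T - fst y)\<^sup>2, 0))"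
    by (intro C1_test_add C1_test_cmult C1_test_log_penalty time par(2))
  have "evolution_operator (\<lambda>x p. (G x p)\<^sup>2) z
      (\<mu> *\<^sub>R log_penalty_grad K (z - z') + \<beta> *\<^sub>R (0, log_penalty_grad 1 (snd z - 0)) +
        (\<eta> + \<kappa> / (T - fst z)\<^sup>2, 0)) \<le> 0"
    by (rule viscosity_subsolutionD[OF sub C1 z(1)]) (use max1 in \<open>simp add: doubled_def algebra_simps\<close>)
  then have sub': "fst P + \<eta> + \<kappa> / (T - fst z)\<^sup>2 \<le> (G (snd z) (snd P + \<beta> *\<^sub>R log_penalty_grad 1 (snd z)))\<^sup>2"
    by (simp add: evolution_operator_def P_def)
  have super0: "0 \<le> evolution_operator (\<lambda>x p. (G x p)\<^sup>2) z'
      ((- \<mu> / k) *\<^sub>R log_penalty_grad K (z' - z) + (0 + (- \<kappa> / k) / (T - fst z')\<^sup>2, 0))"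
  proof (rule viscosity_supersolutionD[OF super C2 z(2)])
    fix y assume "y \<in> \<Omega>"
    then have "k * v z' + \<mu> * log_penalty K (z' - z) + \<kappa> / (T - fst z') \<le>
        k * v y + \<mu> * log_penalty K (y - z) + \<kappa> / (T - fst y)"
      using max2[of y] by (simp add: doubled_def log_penalty_minus_commute[of K z])
    then have "(k * v z' + \<mu> * log_penalty K (z' - z) + \<kappa> / (T - fst z')) / k \<le>
        (k * v y + \<mu> * log_penalty K (y - z) + \<kappa> / (T - fst y)) / k"
      using k by (intro divide_right_mono) auto
    then show "v z' - ((- \<mu> / k) * log_penalty K (z' - z) + (0 * fst z' + (- \<kappa> / k) / (T - fst z'))) \<le>
        v y - ((- \<mu> / k) * log_penalty K (y - z) + (0 * fst y + (- \<kappa> / k) / (T - fst y)))"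
      using k by (simp add: add_divide_distrib mult.commute)
  qed
  have eq: "(- \<mu> / k) *\<^sub>R log_penalty_grad K (z' - z) = (1 / k) *\<^sub>R P"
    unfolding P_def log_penalty_grad_minus[of K z' z] by simp
  have "(1 / k)\<^sup>2 * (G (snd z') (snd P))\<^sup>2 \<le> fst P / k - \<kappa> / k / (T - fst z')\<^sup>2"
    using super0 k unfolding eq by (simp add: evolution_operator_def G_scale power_divide)
  moreover have "0 \<le> \<kappa> / k / (T - fst z')\<^sup>2" using par k by simp
  ultimately have "(1 / k)\<^sup>2 * (G (snd z') (snd P))\<^sup>2 \<le> fst P / k" by linarith
  then have "k * ((1 / k)\<^sup>2 * (G (snd z') (snd P))\<^sup>2) \<le> k * (fst P / k)"
    using k by (intro mult_left_mono) auto
  then have super': "(G (snd z') (snd P))\<^sup>2 / k \<le> fst P"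
    using k by (simp add: power2_eq_square)
  define g where "g = G (snd z') (snd P)"
  have "G (snd z) (snd P + \<beta> *\<^sub>R log_penalty_grad 1 (snd z)) \<le> g + (2 * L * \<mu> + M * \<beta>)"
  proof -
    have "G (snd z) (snd P + \<beta> *\<^sub>R log_penalty_grad 1 (snd z)) \<le>
        G (snd z) (snd P) + M * norm (\<beta> *\<^sub>R log_penalty_grad 1 (snd z))"
      using G_p[of "snd z" "snd P + \<beta> *\<^sub>R log_penalty_grad 1 (snd z)" "snd P"] by simp
    moreover have "M * norm (\<beta> *\<^sub>R log_penalty_grad 1 (snd z)) \<le> M * \<beta>"
      using LM par norm_log_penalty_grad_1_le[of "snd z"]
      by (intro mult_left_mono) (auto intro: mult_left_le)
    moreover have "G (snd z) (snd P) \<le> g + L * (norm (snd z - snd z') * norm (snd P))"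
      unfolding g_def by (rule G_x)
    moreover have "L * (norm (snd z - snd z') * norm (snd P)) \<le> L * (2 * \<mu>)"
    proof (intro mult_left_mono LM)
      have "norm (snd z - snd z') * norm (snd P) \<le> norm (z - z') * norm P"
        using norm_snd_le_norm[of "z - z'"] norm_snd_le_norm[of P]
        by (intro mult_mono) auto
      also have "\<dots> = \<mu> * (norm (z - z') * norm (log_penalty_grad K (z - z')))"
        using par by (simp add: P_def)
      also have "\<dots> \<le> \<mu> * 2"
        using par norm_mult_log_penalty_grad_le[of K "z - z'"] by (intro mult_left_mono) auto
      finally show "norm (snd z - snd z') * norm (snd P) \<le> 2 * \<mu>" by simp
    qed
    ultimately show ?thesis by simp
  qed
  then have "(G (snd z) (snd P + \<beta> *\<^sub>R log_penalty_grad 1 (snd z)))\<^sup>2 \<le> (g + (2 * L * \<mu> + M * \<beta>))\<^sup>2"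
    using G0 by (intro power_mono) auto
  also have "\<dots> \<le> g\<^sup>2 / k + (2 * L * \<mu> + M * \<beta>)\<^sup>2 / (1 - k)"
    using k by (rule power2_add_le_weighted)
  finally have "fst P + \<eta> + \<kappa> / (T - fst z)\<^sup>2 \<le> fst P + (2 * L * \<mu> + M * \<beta>)\<^sup>2 / (1 - k)"
    using sub' super' unfolding g_def by linarith
  moreover have "0 \<le> \<kappa> / (T - fst z)\<^sup>2" using par by simp
  ultimately show ?thesis by linarith
qed

text \<open>Suppose \<open>u - v = \<gamma> > 0\<close> at some point. The parameters are fixed successively: \<open>k\<close> close to 1 and
  the slope \<open>\<eta>\<close> in time so that the functional stays above \<open>\<gamma> / 2\<close>; then \<open>\<mu>\<close> and \<open>\<beta>\<close> so small that
  the error at a maximum is less than \<open>\<eta>\<close>; then \<open>K\<close> so large that the two points are too close for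
  one of them to lie at the initial time, where \<open>u - k v \<le> (1 - k) v\<close> is small; and finally \<open>\<kappa>\<close>, which
  depends on the starting points, to avoid the final time. An interior maximum then contradicts the
  viscosity inequalities.\<close>

lemma evolution_comparison:
  fixes G :: "'a::euclidean_space \<Rightarrow> 'a \<Rightarrow> real" and u v :: "real \<times> 'a \<Rightarrow> real"
    and T :: real
  defines "\<Omega> \<equiv> {0<..<T} \<times> UNIV" and "S \<equiv> {0..T} \<times> UNIV"
  assumes T: "0 < T"
    and G0: "\<And>x p. 0 \<le> G x p"
    and G_scale: "\<And>x p k. 0 < k \<Longrightarrow> G x (k *\<^sub>R p) = k * G x p"
    and G_x: "\<And>x y p. G x p \<le> G y p + L * (norm (x - y) * norm p)"
    and G_p: "\<And>x p q. G x p \<le> G x q + M * norm (p - q)" and LM: "0 \<le> L" "0 \<le> M"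
    and u: "u \<in> BUSC S" and v: "v \<in> BLSC S"
    and sub: "viscosity_subsolution \<Omega> (evolution_operator (\<lambda>x p. (G x p)\<^sup>2)) u"
    and super: "viscosity_supersolution \<Omega> (evolution_operator (\<lambda>x p. (G x p)\<^sup>2)) v"
    and init: "\<And>x. u (0, x) \<le> v (0, x)"
    and t0: "t0 \<in> {0..T}"
    and terminal: "t0 = T \<Longrightarrow> upper_terminal_value T u x0 \<and> lower_terminal_value T v x0"
  shows "u (t0, x0) \<le> v (t0, x0)"
proof (rule ccontr)
  assume contra: "\<not> ?thesis"
  define z0 where "z0 = (t0, x0)"
  define \<gamma> where "\<gamma> = u z0 - v z0"
  have \<gamma>: "\<gamma> > 0" using contra by (simp add: \<gamma>_def z0_def)
  have "t0 \<noteq> 0" using contra init by auto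
  have uscu: "usc_on S u" and uscv: "usc_on S (\<lambda>z. - v z)"
    using u v by (auto simp: BUSC_def BLSC_def lsc_on_iff_usc_on_uminus)
  have z0S: "z0 \<in> S" using t0 by (simp add: z0_def S_def)
  obtain B where B: "B > 0" "\<And>z. z \<in> S \<Longrightarrow> \<bar>u z\<bar> \<le> B" "\<And>z. z \<in> S \<Longrightarrow> \<bar>v z\<bar> \<le> B"
  proof -
    obtain B1 B2 where "\<forall>z\<in>S. \<bar>u z\<bar> \<le> B1" "\<forall>z\<in>S. \<bar>v z\<bar> \<le> B2"
      using u v by (auto simp: BUSC_def BLSC_def bounded_iff)
    then show ?thesis by (intro that[of "max 1 (max B1 B2)"]) fastforce+
  qed
  \<comment> \<open>Points of the open time interval suffice, also for the final time, where the two values may be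
     approached along different sequences.\<close>
  have near_u: "\<exists>z\<in>\<Omega>. dist z z0 < d \<and> u z0 - e < u z" if "e > 0" "d > 0" for e d
  proof (cases "t0 = T")
    case True
    then show ?thesis
      using upper_terminal_value_approached[of T u x0 e d] terminal that by (simp add: \<Omega>_def z0_def)
  next
    case False
    then show ?thesis
      using t0 \<open>t0 \<noteq> 0\<close> that by (intro bexI[of _ z0]) (auto simp: \<Omega>_def z0_def)
  qed
  have near_v: "\<exists>z\<in>\<Omega>. dist z z0 < d \<and> v z < v z0 + e" if "e > 0" "d > 0" for e d
  proof (cases "t0 = T")
    case True
    then show ?thesis
      using lower_terminal_value_approached[of T v x0 e d] terminal that by (simp add: \<Omega>_def z0_def)
  next
    case False
    then show ?thesis
      using t0 \<open>t0 \<noteq> 0\<close> that by (intro bexI[of _ z0]) (auto simp: \<Omega>_def z0_def)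
  qed
  define k where "k = 1 - min (1 / 2) (\<gamma> / (8 * B))"
  have k: "0 < k" "k < 1" using \<gamma> B(1) by (auto simp: k_def)
  have kB: "(1 - k) * B \<le> \<gamma> / 8"
  proof -
    have "(1 - k) * B \<le> (\<gamma> / (8 * B)) * B" using B(1) by (intro mult_right_mono) (auto simp: k_def)
    then show ?thesis using B(1) by simp
  qed
  have kv: "\<bar>(1 - k) * v z\<bar> \<le> \<gamma> / 8" if "z \<in> S" for z
  proof -
    have "\<bar>(1 - k) * v z\<bar> \<le> (1 - k) * B"
      using k B(3)[OF that] by (simp add: abs_mult)
    then show ?thesis using kB by simp
  qed
  define \<eta> where "\<eta> = \<gamma> / (8 * T)"
  have \<eta>: "\<eta> > 0" using \<gamma> T by (simp add: \<eta>_def)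
  define \<delta> where "\<delta> = sqrt (\<eta> * (1 - k)) / 2"
  have \<delta>: "\<delta> > 0" using \<eta> k by (simp add: \<delta>_def)
  have \<delta>_small: "\<delta>\<^sup>2 / (1 - k) < \<eta>"
  proof -
    have "\<delta>\<^sup>2 = \<eta> / 4 * (1 - k)" using \<eta> k by (simp add: \<delta>_def power_divide)
    then have "\<delta>\<^sup>2 / (1 - k) = \<eta> / 4" using k by (subst nonzero_divide_eq_eq) auto
    then show ?thesis using \<eta> by simp
  qed
  define \<mu> where "\<mu> = \<delta> / (4 * (L + 1))"
  have \<mu>: "\<mu> > 0" using \<delta> LM by (simp add: \<mu>_def)
  have L\<mu>: "2 * L * \<mu> \<le> \<delta> / 2"
    using \<delta> LM by (simp add: \<mu>_def field_simps)
  define l0 where "l0 = log_penalty 1 x0"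
  have l0: "l0 \<ge> 0" by (simp add: l0_def log_penalty_nonneg)
  define \<beta> where "\<beta> = min (\<delta> / (2 * (M + 1))) (\<gamma> / (16 * (l0 + 1)))"
  have \<beta>: "\<beta> > 0" using \<delta> LM \<gamma> l0 by (simp add: \<beta>_def)
  have cancel: "c * (a / (b * c)) = a / b" if "c > 0" for a b c :: real
    using that by simp
  have M\<beta>: "M * \<beta> \<le> \<delta> / 2"
  proof -
    have "M * \<beta> \<le> (M + 1) * (\<delta> / (2 * (M + 1)))"
      using LM \<beta> by (intro mult_mono) (auto simp: \<beta>_def)
    also have "\<dots> = \<delta> / 2" using cancel[of "M + 1" \<delta> 2] LM by simp
    finally show ?thesis .
  qed
  have \<beta>l0: "\<beta> * l0 \<le> \<gamma> / 16"
  proof -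
    have "l0 * \<beta> \<le> (l0 + 1) * (\<gamma> / (16 * (l0 + 1)))"
      using l0 \<beta> by (intro mult_mono) (auto simp: \<beta>_def)
    also have "\<dots> = \<gamma> / 16" using cancel[of "l0 + 1" \<gamma> 16] l0 by simp
    finally show ?thesis by (simp add: mult.commute)
  qed
  define R where "R = 1 + exp (2 * B / \<beta>)"
  have R: "R > 0" by (simp add: R_def add_pos_pos)
  have uscd: "usc_on (S \<times> S) (\<lambda>p. u (fst p) + k * (- v (snd p)))"
    by (intro usc_on_add usc_on_cmult k usc_on_compose[OF uscu]
        usc_on_compose[OF uscv] continuous_intros) auto
  obtain \<rho>' where \<rho>': "\<rho>' > 0" "\<And>p z z'. p \<in> {0} \<times> cball 0 (R + 1) \<Longrightarrow> z \<in> S \<Longrightarrow> z' \<in> S \<Longrightarrow>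
      dist p z < \<rho>' \<Longrightarrow> dist p z' < \<rho>' \<Longrightarrow> u z + k * (- v z') < \<gamma> / 4"
  proof -
    have "\<exists>\<rho>>0. \<forall>p\<in>{0} \<times> cball 0 (R + 1). \<forall>z\<in>S. \<forall>z'\<in>S. dist p z < \<rho> \<longrightarrow> dist p z' < \<rho> \<longrightarrow>
        u (fst (z, z')) + k * (- v (snd (z, z'))) < \<gamma> / 4"
    proof (rule usc_on_near_diagonal[OF uscd])
      show "compact ({0 :: real} \<times> cball (0 :: 'a) (R + 1))" by (intro compact_Times) auto
      show sub: "{0} \<times> cball 0 (R + 1) \<subseteq> S" using T by (auto simp: S_def)
      fix p :: "real \<times> 'a" assume p: "p \<in> {0} \<times> cball 0 (R + 1)"
      then have "u p \<le> v p" using init by auto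
      then have "u p + k * (- v p) \<le> (1 - k) * v p" by (simp add: algebra_simps)
      also have "\<dots> \<le> \<gamma> / 8" by (rule order_trans[OF abs_ge_self kv]) (use p sub in auto)
      finally show "u (fst (p, p)) + k * (- v (snd (p, p))) < \<gamma> / 4" using \<gamma> by simp
    qed
    then show ?thesis using that by auto
  qed
  define \<rho> where "\<rho> = min 1 \<rho>'"
  have \<rho>: "\<rho> > 0" using \<rho>' by (simp add: \<rho>_def)
  define K where "K = exp (2 * B / \<mu>) / \<rho>\<^sup>2"
  have K: "K > 0" using \<rho> by (simp add: K_def)
  \<comment> \<open>Starting points near \<open>z0\<close>, where the functional without the \<open>\<kappa>\<close>-terms is large.\<close>
  obtain z1 z1' where z1: "z1 \<in> \<Omega>" "z1' \<in> \<Omega>" "u z0 - \<gamma> / 32 < u z1" "v z1' < v z0 + \<gamma> / 32"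
    "\<mu> * log_penalty K (z1 - z1') + \<beta> * log_penalty 1 (snd z1) < \<gamma> / 16 + \<gamma> / 32"
  proof -
    define pen where "pen p = \<mu> * log_penalty K (fst p - snd p) + \<beta> * log_penalty 1 (snd (fst p))"
      for p :: "(real \<times> 'a) \<times> (real \<times> 'a)"
    have "isCont pen (z0, z0)"
      unfolding pen_def log_penalty_def
      by (intro continuous_intros) (use K in \<open>auto simp: add_nonneg_eq_0_iff\<close>)
    then have "(pen \<longlongrightarrow> pen (z0, z0)) (nhds (z0, z0))"
      by (simp add: isCont_def tendsto_at_iff_tendsto_nhds)
    moreover have "pen (z0, z0) < \<gamma> / 16 + \<gamma> / 32"
      using \<beta>l0 \<gamma> by (simp add: pen_def log_penalty_def l0_def z0_def)
    ultimately have "\<forall>\<^sub>F p in nhds (z0, z0). pen p < \<gamma> / 16 + \<gamma> / 32"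
      by (rule order_tendstoD(2))
    then obtain d where d: "d > 0" "\<And>p. dist p (z0, z0) < d \<Longrightarrow> pen p < \<gamma> / 16 + \<gamma> / 32"
      unfolding eventually_nhds_metric by blast
    obtain a where a: "a \<in> \<Omega>" "dist a z0 < d / 2" "u z0 - \<gamma> / 32 < u a"
      using near_u[of "\<gamma> / 32" "d / 2"] \<gamma> d(1) by auto
    obtain b where b: "b \<in> \<Omega>" "dist b z0 < d / 2" "v b < v z0 + \<gamma> / 32"
      using near_v[of "\<gamma> / 32" "d / 2"] \<gamma> d(1) by auto
    have "dist (a, b) (z0, z0) \<le> dist a z0 + dist b z0"
      unfolding dist_Pair_Pair by (rule sqrt_sum_squares_le_sum) auto
    then have "pen (a, b) < \<gamma> / 16 + \<gamma> / 32" using d(2)[of "(a, b)"] a(2) b(2) by linarith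
    then show ?thesis using that[OF a(1) b(1) a(3) b(3)] by (simp add: pen_def)
  qed
  have z1_time: "0 < fst z1" "fst z1 < T" "0 < fst z1'" "fst z1' < T" using z1(1,2) by (auto simp: \<Omega>_def)
  define \<kappa> where "\<kappa> = \<gamma> / 64 * min (T - fst z1) (T - fst z1')"
  have \<kappa>: "\<kappa> > 0" using \<gamma> z1_time by (simp add: \<kappa>_def)
  have \<kappa>1: "\<kappa> / (T - fst z1) \<le> \<gamma> / 64" "\<kappa> / (T - fst z1') \<le> \<gamma> / 64"
  proof -
    have "\<kappa> \<le> \<gamma> / 64 * (T - fst z1)" "\<kappa> \<le> \<gamma> / 64 * (T - fst z1')"
      unfolding \<kappa>_def using \<gamma> by (intro mult_left_mono; simp)+
    then show "\<kappa> / (T - fst z1) \<le> \<gamma> / 64" "\<kappa> / (T - fst z1') \<le> \<gamma> / 64"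
      using z1_time by (simp_all add: pos_divide_le_eq)
  qed
  define \<Phi> where "\<Phi> p = doubled T k \<mu> K \<beta> \<eta> \<kappa> u v (fst p) (snd p)" for p
  have start: "\<gamma> / 2 < \<Phi> (z1, z1')"
  proof -
    have "k * v z1' \<le> k * v z0 + \<gamma> / 32"
    proof -
      have "k * v z1' \<le> k * (v z0 + \<gamma> / 32)" using z1(4) k by (intro mult_left_mono) auto
      also have "\<dots> = k * v z0 + k * (\<gamma> / 32)" by (rule distrib_left)
      also have "k * (\<gamma> / 32) \<le> 1 * (\<gamma> / 32)" using k \<gamma> by (intro mult_right_mono) auto
      finally show ?thesis by simp
    qed
    moreover have "u z0 - k * v z0 = \<gamma> + (1 - k) * v z0" by (simp add: \<gamma>_def algebra_simps)
    moreover have "- (\<gamma> / 8) \<le> (1 - k) * v z0" using kv[OF z0S] by (simp add: abs_le_iff)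
    moreover have "\<eta> * fst z1 \<le> \<gamma> / 8"
    proof -
      have "\<eta> * fst z1 \<le> \<eta> * T" using \<eta> z1_time by (intro mult_left_mono) auto
      then show ?thesis using T by (simp add: \<eta>_def)
    qed
    ultimately show ?thesis
      using z1(3,5) \<kappa>1 \<gamma> unfolding \<Phi>_def doubled_def fst_conv snd_conv by linarith
  qed
  define S' where "S' = {0..<T} \<times> (UNIV :: 'a set)"
  have S'S: "S' \<subseteq> S" by (auto simp: S'_def S_def)
  define \<epsilon> where "\<epsilon> = \<kappa> / (2 * B)"
  have \<epsilon>: "\<epsilon> > 0" using \<kappa> B(1) by (simp add: \<epsilon>_def)
  define C where "C = ({0..T - \<epsilon>} \<times> cball (0 :: 'a) R) \<times> ({0..T - \<epsilon>} \<times> cball (0 :: 'a) (R + 1))"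
  \<comment> \<open>Where the functional is positive, each of its penalties is less than \<open>2 B\<close>.\<close>
  have local: "(z, z') \<in> C \<and> norm (z - z') < \<rho>" if z: "z \<in> S'" "z' \<in> S'" and pos: "0 < \<Phi> (z, z')"
    for z z'
  proof -
    have time: "0 \<le> fst z" "fst z < T" "0 \<le> fst z'" "fst z' < T" using z by (auto simp: S'_def)
    have nonneg: "0 \<le> \<mu> * log_penalty K (z - z')" "0 \<le> \<beta> * log_penalty 1 (snd z)" "0 \<le> \<eta> * fst z"
      "0 \<le> \<kappa> / (T - fst z)" "0 \<le> \<kappa> / (T - fst z')"
      using \<mu> \<beta> \<eta> \<kappa> K time by (simp_all add: log_penalty_nonneg)
    have zS: "z \<in> S" "z' \<in> S" using z S'S by blast+
    have "\<bar>k * v z'\<bar> \<le> 1 * B"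
      unfolding abs_mult using k B(3)[OF zS(2)] by (intro mult_mono) auto
    then have "u z - k * v z' \<le> 2 * B" using B(2)[OF zS(1)] by (simp add: abs_le_iff)
    then have lt: "\<mu> * log_penalty K (z - z') < 2 * B" "\<beta> * log_penalty 1 (snd z) < 2 * B"
      "\<kappa> / (T - fst z) < 2 * B" "\<kappa> / (T - fst z') < 2 * B"
      using pos nonneg unfolding \<Phi>_def doubled_def fst_conv snd_conv by linarith+
    have "log_penalty K (z - z') < 2 * B / \<mu>" using lt(1) \<mu> by (simp add: field_simps)
    then have "K * (norm (z - z'))\<^sup>2 < exp (2 * B / \<mu>)" using K by (intro log_penalty_less_imp) auto
    then have "exp (2 * B / \<mu>) * ((norm (z - z'))\<^sup>2 / \<rho>\<^sup>2) < exp (2 * B / \<mu>) * 1"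
      by (simp add: K_def)
    then have "(norm (z - z'))\<^sup>2 / \<rho>\<^sup>2 < 1"
      by (rule mult_left_less_imp_less) simp
    then have "(norm (z - z'))\<^sup>2 < \<rho>\<^sup>2" using \<rho> by simp
    then have close: "norm (z - z') < \<rho>" by (rule power2_less_imp_less) (use \<rho> in simp)
    have "log_penalty 1 (snd z) < 2 * B / \<beta>" using lt(2) \<beta> by (simp add: field_simps)
    then have "1 * (norm (snd z))\<^sup>2 < exp (2 * B / \<beta>)" by (intro log_penalty_less_imp) auto
    also have "\<dots> \<le> R\<^sup>2" by (simp add: R_def power2_sum)
    finally have "(norm (snd z))\<^sup>2 < R\<^sup>2" by simp
    then have x: "norm (snd z) < R" by (rule power2_less_imp_less) (use R in simp)
    have "norm (snd z') \<le> norm (snd z) + norm (snd z' - snd z)"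
      using norm_triangle_ineq[of "snd z" "snd z' - snd z"] by simp
    moreover have "norm (snd z' - snd z) \<le> norm (z - z')"
      using norm_snd_le_norm[of "z' - z"] by (simp add: norm_minus_commute)
    ultimately have x': "norm (snd z') \<le> R + 1" using x close by (simp add: \<rho>_def)
    have "fst z \<le> T - \<epsilon>" "fst z' \<le> T - \<epsilon>"
      using lt(3,4) time B(1) by (simp_all add: \<epsilon>_def field_simps)
    then show ?thesis using time x x' close by (cases z; cases z') (auto simp: C_def)
  qed
  have "\<exists>p\<in>C. \<forall>y\<in>S' \<times> S'. \<Phi> y \<le> \<Phi> p"
  proof (rule usc_on_attains_global_max[where a = "(z1, z1')"])
    show "compact C" unfolding C_def by (intro compact_Times compact_Icc compact_cball)
    show "C \<subseteq> S' \<times> S'" using \<epsilon> by (auto simp: C_def S'_def)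
    have "usc_on (S' \<times> S') (\<lambda>p. (u (fst p) + k * (- v (snd p))) +
      (- (\<mu> * log_penalty K (fst p - snd p) + \<beta> * log_penalty 1 (snd (fst p)) + \<eta> * fst (fst p)
        + \<kappa> / (T - fst (fst p)) + \<kappa> / (T - fst (snd p)))))"
      unfolding log_penalty_def
    proof (intro usc_on_add[OF usc_on_subset[OF uscd]] continuous_on_imp_usc_on continuous_intros)
    qed (use S'S K in \<open>auto simp: S'_def add_nonneg_eq_0_iff\<close>)
    then show "usc_on (S' \<times> S') \<Phi>"
      by (rule back_subst[of "usc_on (S' \<times> S')"]) (simp add: fun_eq_iff \<Phi>_def doubled_def)
    have in_S': "z1 \<in> S'" "z1' \<in> S'" using z1(1,2) by (auto simp: \<Omega>_def S'_def)
    show "(z1, z1') \<in> C" using local[OF in_S'] start \<gamma> by simp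
    show "\<Phi> p \<le> \<Phi> (z1, z1')" if "p \<in> S' \<times> S'" "p \<notin> C" for p
      using local[of "fst p" "snd p"] that start \<gamma> by (cases p) force
  qed
  then obtain z z' where zC: "(z, z') \<in> C" and zmax: "\<And>y y'. y \<in> S' \<Longrightarrow> y' \<in> S' \<Longrightarrow> \<Phi> (y, y') \<le> \<Phi> (z, z')"
    by force
  have zS': "z \<in> S'" "z' \<in> S'" using zC \<epsilon> by (auto simp: C_def S'_def)
  have big: "\<gamma> / 2 < \<Phi> (z, z')"
    using zmax[of z1 z1'] start z1(1,2) by (auto simp: \<Omega>_def S'_def)
  then have close: "norm (z - z') < \<rho>" using local[OF zS'] \<gamma> by simp
  have gap: "\<gamma> / 2 < u z + k * (- v z')"
  proof -
    have "0 \<le> \<mu> * log_penalty K (z - z')" "0 \<le> \<beta> * log_penalty 1 (snd z)" "0 \<le> \<eta> * fst z"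
      "0 \<le> \<kappa> / (T - fst z)" "0 \<le> \<kappa> / (T - fst z')"
      using \<mu> \<beta> \<eta> \<kappa> K zS' by (auto simp: log_penalty_nonneg S'_def)
    then show ?thesis using big unfolding \<Phi>_def doubled_def fst_conv snd_conv by linarith
  qed
  have "dist z z' < \<rho>'" using close by (simp add: dist_norm \<rho>_def)
  have "fst z \<noteq> 0"
  proof
    assume "fst z = 0"
    then have "z \<in> {0} \<times> cball 0 (R + 1)" using zC by (cases z) (auto simp: C_def)
    then have "u z + k * (- v z') < \<gamma> / 4"
      by (rule \<rho>'(2)) (use zS' S'S \<rho>'(1) \<open>dist z z' < \<rho>'\<close> in auto)
    then show False using gap \<gamma> by simp
  qed
  moreover have "fst z' \<noteq> 0"
  proof
    assume "fst z' = 0"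
    then have "z' \<in> {0} \<times> cball 0 (R + 1)" using zC by (cases z') (auto simp: C_def)
    then have "u z + k * (- v z') < \<gamma> / 4"
      by (rule \<rho>'(2)) (use zS' S'S \<rho>'(1) \<open>dist z z' < \<rho>'\<close> in \<open>auto simp: dist_commute\<close>)
    then show False using gap \<gamma> by simp
  qed
  ultimately have z\<Omega>: "z \<in> \<Omega>" "z' \<in> \<Omega>" using zS' by (auto simp: \<Omega>_def S'_def)
  have \<Omega>S': "y \<in> S'" if "y \<in> \<Omega>" for y using that by (auto simp: \<Omega>_def S'_def)
  have "\<eta> \<le> (2 * L * \<mu> + M * \<beta>)\<^sup>2 / (1 - k)"
  proof (rule doubled_max_imp[OF G0 G_scale G_x G_p LM sub[unfolded \<Omega>_def] super[unfolded \<Omega>_def] k])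
    show "0 \<le> \<mu>" "0 \<le> K" "0 \<le> \<beta>" "0 \<le> \<kappa>" using \<mu> K \<beta> \<kappa> by auto
    show "z \<in> {0<..<T} \<times> UNIV" "z' \<in> {0<..<T} \<times> UNIV" using z\<Omega> by (simp_all add: \<Omega>_def)
    fix y :: "real \<times> 'a" assume "y \<in> {0<..<T} \<times> UNIV"
    then have "y \<in> S'" by (intro \<Omega>S') (simp add: \<Omega>_def)
    then show "doubled T k \<mu> K \<beta> \<eta> \<kappa> u v y z' \<le> doubled T k \<mu> K \<beta> \<eta> \<kappa> u v z z'"
      "doubled T k \<mu> K \<beta> \<eta> \<kappa> u v z y \<le> doubled T k \<mu> K \<beta> \<eta> \<kappa> u v z z'"
      using zmax[OF _ zS'(2), of y] zmax[OF zS'(1), of y] by (simp_all add: \<Phi>_def)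
  qed
  also have "\<dots> \<le> \<delta>\<^sup>2 / (1 - k)"
  proof (intro divide_right_mono power_mono)
    show "2 * L * \<mu> + M * \<beta> \<le> \<delta>" using L\<mu> M\<beta> by simp
    show "0 \<le> 2 * L * \<mu> + M * \<beta>" using LM \<mu> \<beta> by simp
  qed (use k in simp)
  also have "\<dots> < \<eta>" by (rule \<delta>_small)
  finally show False by simp
qed

theorem theorem5p4:
  fixes T \<theta> :: real
    and \<sigma> :: "real^'n \<Rightarrow> real^'m \<Rightarrow> real^'r^'n"
    and \<tau> :: "real^'m \<Rightarrow> real^'r^'m"
    and h :: "real^'n \<Rightarrow> real"
    and u v :: "real \<times> (real^'n) \<Rightarrow> real"
  assumes "T > 0"
    and "bounded (range (\<lambda>(x, y). \<sigma> x y))"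
    and "\<exists>L. L-lipschitz_on UNIV (\<lambda>(x, y). \<sigma> x y)"
    and "\<forall>x. Z_periodic (\<sigma> x)"
    and "locally_lipschitz \<tau>"
    and "Z_periodic \<tau>"
    and "\<theta> > 0"
    and "\<forall>y \<xi>. \<xi> \<noteq> 0 \<longrightarrow> (norm (transpose (\<tau> y) *v \<xi>))\<^sup>2 > \<theta> * (norm \<xi>)\<^sup>2"
    and "h \<in> BC"
    and "u \<in> BUSC ({0..T} \<times> UNIV)"
    and "v \<in> BLSC ({0..T} \<times> UNIV)"
    and "viscosity_subsolution ({0<..<T} \<times> UNIV)
           (evolution_operator (effective_hamiltonian \<sigma> \<tau>)) u"
    and "viscosity_supersolution ({0<..<T} \<times> UNIV)
           (evolution_operator (effective_hamiltonian \<sigma> \<tau>)) v"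
    and "\<forall>x. u (0, x) \<le> h x \<and> h x \<le> v (0, x)"
  shows "\<forall>x. \<forall>t\<in>{0..T}.
           (t = T \<longrightarrow> upper_terminal_value T u x \<and> lower_terminal_value T v x) \<longrightarrow>
           u (t, x) \<le> v (t, x)"
proof -
  obtain L where L: "L-lipschitz_on UNIV (\<lambda>(x, y). \<sigma> x y)" using assms(3) by blast
  have L0: "L \<ge> 0" using L by (simp add: lipschitz_on_def)
  have L_le: "norm (\<sigma> x y - \<sigma> x' y') \<le> L * dist (x, y) (x', y')" for x y x' y'
    using lipschitz_onD[OF L, of "(x, y)" "(x', y')"] by (simp add: dist_norm)
  interpret effective_cell \<tau> \<theta> \<sigma>
  proof
    show "continuous_on UNIV \<tau>" by (rule locally_lipschitz_imp_continuous_on[OF assms(5)])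
    show "Z_periodic \<tau>" "\<theta> > 0" "Z_periodic (\<sigma> x)" for x using assms(4,6,7) by auto
    show "\<theta> * (norm q)\<^sup>2 \<le> (norm (transpose (\<tau> y) *v q))\<^sup>2" for q y
      using assms(8) by (cases "q = 0") (auto intro: less_imp_le simp del: transpose_matrix_vector)
    show "continuous_on UNIV (\<sigma> x)" for x
    proof (rule lipschitz_on_continuous_on[of L])
      show "L-lipschitz_on UNIV (\<sigma> x)"
        using L_le[of x _ x] L0 by (simp add: lipschitz_on_def dist_norm dist_Pair_Pair)
    qed
  qed
  obtain S where S: "\<And>x y. norm (\<sigma> x y) \<le> S"
    using assms(2) unfolding bounded_iff by auto
  have S0: "S \<ge> 0" by (rule order_trans[OF norm_ge_zero S])
  obtain B where B: "B > 0" "\<And>(A :: real^'r^'n) q. norm (transpose A *v q) \<le> norm A * norm q * B"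
    using bounded_bilinear.pos_bounded[OF bounded_bilinear_transpose_matrix_vector] by blast
  define G where "G x p = sqrt (Heff x p)" for x p
  have GH: "Heff = (\<lambda>x p. (G x p)\<^sup>2)" by (simp add: fun_eq_iff G_def Heff_nonneg)
  have G_x: "G x p \<le> G y p + (L * B) * (norm (x - y) * norm p)" for x y p
    unfolding G_def
  proof (rule sqrt_Heff_le)
    fix z
    have "forcing y p z - forcing x p z = transpose (\<sigma> y z - \<sigma> x z) *v p"
      unfolding forcing_def
      by (rule bounded_bilinear.diff_left[OF bounded_bilinear_transpose_matrix_vector, symmetric])
    also have "norm \<dots> \<le> norm (\<sigma> y z - \<sigma> x z) * norm p * B" by (rule B)
    also have "\<dots> \<le> L * norm (x - y) * norm p * B"
      using L_le[of y z x z] B(1)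
      by (intro mult_right_mono) (auto simp: dist_Pair_Pair dist_norm norm_minus_commute)
    finally show "norm (forcing y p z - forcing x p z) \<le> L * B * (norm (x - y) * norm p)"
      by (simp add: mult_ac)
  qed
  have G_p: "G x p \<le> G x q + (S * B) * norm (p - q)" for x p q
    unfolding G_def
  proof (rule sqrt_Heff_le)
    fix z
    have "forcing x q z - forcing x p z = transpose (\<sigma> x z) *v (q - p)"
      unfolding forcing_def
      by (rule bounded_bilinear.diff_right[OF bounded_bilinear_transpose_matrix_vector, symmetric])
    also have "norm \<dots> \<le> norm (\<sigma> x z) * norm (q - p) * B" by (rule B)
    also have "\<dots> \<le> S * norm (q - p) * B"
      using S B(1) by (intro mult_right_mono) auto
    finally show "norm (forcing x q z - forcing x p z) \<le> S * B * norm (p - q)"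
      by (simp add: mult_ac norm_minus_commute)
  qed
  have G_scale: "G x (k *\<^sub>R p) = k * G x p" if "0 < k" for x p k
    using that by (simp add: G_def Heff_scale real_sqrt_mult)
  have init: "u (0, x) \<le> v (0, x)" for x using assms(14) order_trans by blast
  show ?thesis
  proof (intro allI ballI impI)
    fix x t assume t: "t \<in> {0..T}"
      and terminal: "t = T \<longrightarrow> upper_terminal_value T u x \<and> lower_terminal_value T v x"
    show "u (t, x) \<le> v (t, x)"
    proof (rule evolution_comparison[OF assms(1) _ G_scale G_x G_p _ _ assms(10,11) _ _ init t])
      show "0 \<le> G x p" for x p by (simp add: G_def Heff_nonneg)
      show "0 \<le> L * B" "0 \<le> S * B" using L0 S0 B(1) by auto
    qed (use terminal assms(12,13) in \<open>simp_all add: GH\<close>)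
  qed
qed

end
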